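(* Let $m\ge1$. There exists a unique most-perfect magic hypercube of order $4$ and dimension $m$ (with entries $1,\ldots,4^m$) up to the natural, faithful action of the group $W(B_{2m})\cong\mathrm{Aut}(Q_{2m})\cong\mathrm{Aut}_{\mathrm{graph}}(C_4^m)\cong C_2^{2m}\rtimes S_{2m}$; that is, the set of such hypercubes is nonempty and forms a single orbit under this faithful action.
   Context: A most-perfect magic hypercube of order $4$ and dimension $m$ is an arrangement of the numbers $1,2,\ldots,4^m$ in a $4\times\cdots\times4$ ($m$-fold) grid, with positions indexed by $(\mathbb Z/4\mathbb Z)^m$, such that: all orthogonal lines (four positions obtained by fixing all but one coordinate), all $2\times2$ subsquares (positions obtained by fixing all but two coordinates and letting those two range over $\{i,i+1\}\times\{k,k+1\}$ modulo $4$, so wrap-around subsquares are included), and all great diagonals and great pandiagonals sum to the same magic constant; and all pairs of entries lying two apart on any great pandiagonal sum to half the magic constant. A great pandiagonal is a toroidal line $\{p+t\,d: t\in\mathbb Z/4\mathbb Z\}$ with $p\in(\mathbb Z/4\mathbb Z)^m$ and $d\in\{\pm1\}^m$; great diagonals (the main diagonals of the grid) are special cases. $Q_{2m}$ is the hypercube graph on $\{0,1\}^{2m}$; $C_4^m$ is the $m$-fold Cartesian product of the $4$-cycle, i.e. the toroidal grid graph on the positions, which is isomorphic as a graph to $Q_{2m}$. The natural action is by permuting positions via graph automorphisms of $C_4^m$. $W(B_{2m})$ is the Weyl group of type $B_{2m}$ (the hyperoctahedral group of order $2^{2m}(2m)!$). *)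

theory Defs
  imports
    "HOL-Algebra.Algebra"
    "HOL-Library.Numeral_Type"
    "Jordan_Normal_Form.Matrix"
begin

text \<open>The type \<open>4\<close> of \<^theory>\<open>HOL-Library.Numeral_Type\<close> is the ring of integers modulo 4,
  so coordinates wrap around automatically.\<close>

definition positions :: "nat \<Rightarrow> (nat \<Rightarrow> 4) set" where
  "positions m = {..<m} \<rightarrow>\<^sub>E UNIV"

definition orthogonal_line :: "nat \<Rightarrow> (nat \<Rightarrow> 4) \<Rightarrow> (nat \<Rightarrow> 4) set" where
  "orthogonal_line i p = {p(i := t) | t. True}"

definition subsquare :: "nat \<Rightarrow> nat \<Rightarrow> 4 \<Rightarrow> 4 \<Rightarrow> (nat \<Rightarrow> 4) \<Rightarrow> (nat \<Rightarrow> 4) set" where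
  "subsquare i j a b p = {p(i := x, j := y) | x y. x \<in> {a, a + 1} \<and> y \<in> {b, b + 1}}"

definition directions :: "nat \<Rightarrow> (nat \<Rightarrow> 4) set" where
  "directions m = {..<m} \<rightarrow>\<^sub>E {1, -1}"

definition translate :: "nat \<Rightarrow> (nat \<Rightarrow> 4) \<Rightarrow> 4 \<Rightarrow> (nat \<Rightarrow> 4) \<Rightarrow> (nat \<Rightarrow> 4)" where
  "translate m p t d = (\<lambda>i\<in>{..<m}. p i + t * d i)"

text \<open>The base point ranges over all positions, so the great diagonals of the grid are included.\<close>

definition great_pandiagonal :: "nat \<Rightarrow> (nat \<Rightarrow> 4) \<Rightarrow> (nat \<Rightarrow> 4) \<Rightarrow> (nat \<Rightarrow> 4) set" where
  "great_pandiagonal m p d = {translate m p t d | t. True}"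

text \<open>An arrangement is extensional (undefined off the grid), so that equality of hypercubes is
  equality of their entries. The last conjunct says that two entries lying two apart on a great
  pandiagonal sum to \<open>M / 2\<close>.\<close>

definition most_perfect :: "nat \<Rightarrow> ((nat \<Rightarrow> 4) \<Rightarrow> nat) \<Rightarrow> bool" where
  "most_perfect m h \<longleftrightarrow>
     (\<exists>M.
       (\<forall>p\<in>positions m. \<forall>i<m. (\<Sum>q\<in>orthogonal_line i p. h q) = M) \<and>
       (\<forall>p\<in>positions m. \<forall>i<m. \<forall>j<m. i \<noteq> j \<longrightarrow>
          (\<forall>a b. (\<Sum>q\<in>subsquare i j a b p. h q) = M)) \<and>
       (\<forall>p\<in>positions m. \<forall>d\<in>directions m. (\<Sum>q\<in>great_pandiagonal m p d. h q) = M) \<and>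
       (\<forall>p\<in>positions m. \<forall>d\<in>directions m. \<forall>t.
          2 * (h (translate m p t d) + h (translate m p (t + 2) d)) = M))"

definition most_perfect_hypercubes :: "nat \<Rightarrow> ((nat \<Rightarrow> 4) \<Rightarrow> nat) set" where
  "most_perfect_hypercubes m =
     {h \<in> extensional (positions m). bij_betw h (positions m) {1..4 ^ m} \<and> most_perfect m h}"

definition graph_aut :: "'a set \<Rightarrow> ('a \<Rightarrow> 'a \<Rightarrow> bool) \<Rightarrow> ('a \<Rightarrow> 'a) monoid" where
  "graph_aut V adj = (BijGroup V)
     \<lparr>carrier := {f \<in> Bij V. \<forall>x\<in>V. \<forall>y\<in>V. adj (f x) (f y) \<longleftrightarrow> adj x y}\<rparr>"

definition cycle4_adj :: "4 \<Rightarrow> 4 \<Rightarrow> bool" where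
  "cycle4_adj x y \<longleftrightarrow> y = x + 1 \<or> x = y + 1"

definition torus_adj :: "nat \<Rightarrow> (nat \<Rightarrow> 4) \<Rightarrow> (nat \<Rightarrow> 4) \<Rightarrow> bool" where
  "torus_adj m p q \<longleftrightarrow> (\<exists>i<m. cycle4_adj (p i) (q i) \<and> (\<forall>j<m. j \<noteq> i \<longrightarrow> p j = q j))"

definition torus_aut :: "nat \<Rightarrow> ((nat \<Rightarrow> 4) \<Rightarrow> (nat \<Rightarrow> 4)) monoid" where
  "torus_aut m = graph_aut (positions m) (torus_adj m)"

definition cube_vertices :: "nat \<Rightarrow> (nat \<Rightarrow> nat) set" where
  "cube_vertices n = {..<n} \<rightarrow>\<^sub>E {0, 1}"

definition cube_adj :: "nat \<Rightarrow> (nat \<Rightarrow> nat) \<Rightarrow> (nat \<Rightarrow> nat) \<Rightarrow> bool" where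
  "cube_adj n x y \<longleftrightarrow> card {i. i < n \<and> x i \<noteq> y i} = 1"

definition cube_aut :: "nat \<Rightarrow> ((nat \<Rightarrow> nat) \<Rightarrow> (nat \<Rightarrow> nat)) monoid" where
  "cube_aut n = graph_aut (cube_vertices n) (cube_adj n)"

text \<open>\<open>g\<close> moves the entry at position \<open>p\<close> to position \<open>g p\<close>. The restrictions put the maps into
  \<^const>\<open>BijGroup\<close>, whose elements are extensional.\<close>

definition hypercube_action ::
    "nat \<Rightarrow> ((nat \<Rightarrow> 4) \<Rightarrow> (nat \<Rightarrow> 4)) \<Rightarrow> ((nat \<Rightarrow> 4) \<Rightarrow> nat) \<Rightarrow> ((nat \<Rightarrow> 4) \<Rightarrow> nat)" where
  "hypercube_action m g =
     (\<lambda>h\<in>most_perfect_hypercubes m. \<lambda>p\<in>positions m. h (inv_into (positions m) g p))"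

definition roots_B :: "nat \<Rightarrow> real vec set" where
  "roots_B n =
     {s \<cdot>\<^sub>v unit_vec n i | s i. s \<in> {1, -1} \<and> i < n} \<union>
     {s \<cdot>\<^sub>v unit_vec n i + t \<cdot>\<^sub>v unit_vec n j | s t i j.
        s \<in> {1, -1} \<and> t \<in> {1, -1} \<and> i < n \<and> j < n \<and> i \<noteq> j}"

definition reflection :: "nat \<Rightarrow> real vec \<Rightarrow> real vec \<Rightarrow> real vec" where
  "reflection n a = (\<lambda>v\<in>carrier_vec n. v - (2 * (v \<bullet> a) / (a \<bullet> a)) \<cdot>\<^sub>v a)"

definition weyl_B :: "nat \<Rightarrow> (real vec \<Rightarrow> real vec) monoid" where
  "weyl_B n = subgroup_generated (BijGroup (carrier_vec n)) (reflection n ` roots_B n)"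

definition semidirect_product ::
    "('a, 'c) monoid_scheme \<Rightarrow> ('b, 'd) monoid_scheme \<Rightarrow> ('b \<Rightarrow> 'a \<Rightarrow> 'a) \<Rightarrow> ('a \<times> 'b) monoid" where
  "semidirect_product N H \<theta> =
     \<lparr>carrier = carrier N \<times> carrier H,
      monoid.mult = (\<lambda>(a, s) (b, t). (a \<otimes>\<^bsub>N\<^esub> \<theta> s b, s \<otimes>\<^bsub>H\<^esub> t)),
      one = (\<one>\<^bsub>N\<^esub>, \<one>\<^bsub>H\<^esub>)\<rparr>"

text \<open>The symmetric group acts on \<open>C\<^sub>2\<^sup>n\<close> by permuting the factors; the inverse
  makes this a left action. Coordinates are indexed by \<open>{1..n}\<close> to match \<^const>\<open>sym_group\<close>.\<close>

definition C2_power_semidirect_sym :: "nat \<Rightarrow> ((nat \<Rightarrow> int) \<times> (nat \<Rightarrow> nat)) monoid" where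
  "C2_power_semidirect_sym n =
     semidirect_product (product_group {1..n} (\<lambda>_. integer_mod_group 2)) (sym_group n)
       (\<lambda>s v. \<lambda>i\<in>{1..n}. v (inv_into UNIV s i))"

end

theory Submission
  imports Defs
begin

text \<open>Put \<open>n = 2 m\<close>. A Gray code identifies \<open>C\<^sub>4\<^sup>m\<close> with the hypercube graph
  \<open>Q\<^sub>n\<close>. Orthogonal lines and \<open>2 \<times> 2\<close> subsquares are then exactly the two-dimensional faces,
  and positions two apart on a great pandiagonal are antipodes, so being most-perfect is a property
  of \<open>Q\<^sub>n\<close> invariant under its automorphisms. Constant face sums force
  \<open>h x = (2\<^sup>n + 1 + \<chi> x * (\<Sum>i<n. (- 1) ^ x i * b i)) / 2\<close>, where
  \<open>\<chi> x\<close> is the parity sign of the vertex \<open>x\<close>. As \<open>n\<close> is even,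
  \<open>x \<mapsto> (\<chi> x * (- 1) ^ x i)\<^sub>i\<close> is a bijection onto all sign vectors, so \<open>h\<close> is
  a bijection onto \<open>{1..2\<^sup>n}\<close> iff the subset sums of the \<open>\<bar>b i\<bar>\<close> are
  \<open>0, \<dots>, 2\<^sup>n - 1\<close>, i.e. iff the \<open>\<bar>b i\<bar>\<close> are the powers
  \<open>1, 2, \<dots>, 2 ^ (n - 1)\<close> in some order. Signed permutations of the coordinates, which
  are all the automorphisms of \<open>Q\<^sub>n\<close>, permute these weight vectors transitively.\<close>

section \<open>The hyperoctahedral group and its signed permutation representations\<close>

text \<open>The semidirect product is the hub of the isomorphisms: it acts faithfully by signed
  permutations on the vertices of Q_n and on real vectors, so identifying it with another group
  amounts to computing an image. The parity sign \<chi> changes along every edge. Hence the sum of a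
  function F over the ends of an edge is, up to sign, a difference of \<chi> * F, and vanishing sums
  over faces become vanishing second differences. Evenness of n decides what the antipodal condition
  does. Antipodes have equal parity sign, so for the centred entries it removes the constant part of
  \<chi> * F and keeps the linear one. For odd n it would remove the linear part and leave two
  values only. Changing signs of coordinates also changes \<chi>, by the product of these signs, so
  matching an arrangement with the standard one needs a global correction of the signs. The action
  is faithful because the entries of a hypercube are distinct: one hypercube already separates all
  automorphisms.\<close>

lemma carrier_C2_sym_iff:
  "(a, s) \<in> carrier (C2_power_semidirect_sym n) \<longleftrightarrow>
     a \<in> {1..n} \<rightarrow>\<^sub>E {0, 1} \<and> s permutes {1..n}"
proof -
  have "{0..<2} = {0, 1 :: int}"
    by auto
  then show ?thesis
    by (simp add: C2_power_semidirect_sym_def semidirect_product_def sym_group_def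
        integer_mod_group_def)
qed

lemma mult_C2_sym:
  "(a, s) \<otimes>\<^bsub>C2_power_semidirect_sym n\<^esub> (b, t) =
     (\<lambda>i\<in>{1..n}. (a i + (\<lambda>i\<in>{1..n}. b (inv_into UNIV s i)) i) mod 2, s \<circ> t)"
  by (simp add: C2_power_semidirect_sym_def semidirect_product_def sym_group_def
      integer_mod_group_def product_group_def)

lemma one_C2_sym: "\<one>\<^bsub>C2_power_semidirect_sym n\<^esub> = (\<lambda>i\<in>{1..n}. 0, id)"
  by (simp add: C2_power_semidirect_sym_def semidirect_product_def sym_group_def
      integer_mod_group_def product_group_def)

lemma permutes_inv_into_mem:
  assumes "s permutes A" "i \<in> A"
  shows "inv_into UNIV s i \<in> A"
  using assms by (meson permutes_in_image permutes_inv)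

text \<open>Coordinates of vertices and vectors are numbered from 0, whereas
  \<open>sym_group n\<close> permutes {1..n}. This shift turns a permutation of coordinates into a
  group element.\<close>

lemma permutes_shift:
  fixes p :: "nat \<Rightarrow> nat"
  assumes inj: "inj_on p {..<n}" and sub: "p ` {..<n} \<subseteq> {..<n}"
  shows "(\<lambda>i. if i \<in> {1..n} then Suc (p (i - 1)) else i) permutes {1..n}" (is "?s permutes _")
proof (rule bij_imp_permutes)
  have "inj_on ?s {1..n}"
  proof (rule inj_onI)
    fix i j assume ij: "i \<in> {1..n}" "j \<in> {1..n}" "?s i = ?s j"
    then have "p (i - 1) = p (j - 1)"
      by simp
    moreover have "i - 1 \<in> {..<n}" "j - 1 \<in> {..<n}"
      using ij by auto
    ultimately have "i - 1 = j - 1"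
      using inj by (auto dest: inj_onD)
    then show "i = j"
      using ij by auto
  qed
  moreover have "?s ` {1..n} \<subseteq> {1..n}"
  proof (rule image_subsetI)
    fix i assume "i \<in> {1..n}"
    then have "i - 1 \<in> {..<n}"
      by auto
    then have "p (i - 1) < n"
      using sub by blast
    then show "?s i \<in> {1..n}"
      using \<open>i \<in> {1..n}\<close> by auto
  qed
  ultimately show "bij_betw ?s {1..n} {1..n}"
    unfolding bij_betw_def by (intro conjI endo_inj_surj) auto
qed auto

text \<open>\<open>semidirect_product\<close> only builds a record, so the laws are checked on
  pairs. Associativity rests on (s t)^-1 = t^-1 s^-1, which makes the twist a left action.\<close>

lemma C2_sym_group: "group (C2_power_semidirect_sym n)" (is "group ?G")
proof (rule groupI)
  show "x \<otimes>\<^bsub>?G\<^esub> y \<in> carrier ?G" if "x \<in> carrier ?G" "y \<in> carrier ?G" for x y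
    using that
    by (cases x; cases y) (auto simp: carrier_C2_sym_iff mult_C2_sym mod2_eq_if permutes_compose)
  show "\<one>\<^bsub>?G\<^esub> \<in> carrier ?G"
    by (auto simp: one_C2_sym carrier_C2_sym_iff permutes_id)
  show "x \<otimes>\<^bsub>?G\<^esub> y \<otimes>\<^bsub>?G\<^esub> z = x \<otimes>\<^bsub>?G\<^esub> (y \<otimes>\<^bsub>?G\<^esub> z)"
    if "x \<in> carrier ?G" "y \<in> carrier ?G" "z \<in> carrier ?G" for x y z
  proof -
    obtain a s b t c u where e: "x = (a, s)" "y = (b, t)" "z = (c, u)"
      by (metis surj_pair)
    have s: "s permutes {1..n}" and t: "t permutes {1..n}"
      using that e by (auto simp: carrier_C2_sym_iff)
    have i: "inv_into UNIV (s \<circ> t) i = inv_into UNIV t (inv_into UNIV s i)" for i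
      using s t by (metis comp_apply o_inv_distrib permutes_bij)
    have m: "inv_into UNIV s i \<in> {1..n}" if "i \<in> {1..n}" for i
      using permutes_inv_into_mem[OF s that] .
    show ?thesis
      unfolding e mult_C2_sym
      using m by (auto simp: i o_assoc mod_simps add.assoc intro!: restrict_ext)
  qed
  show "\<one>\<^bsub>?G\<^esub> \<otimes>\<^bsub>?G\<^esub> x = x" if "x \<in> carrier ?G" for x
  proof -
    obtain a s where e: "x = (a, s)"
      by (cases x)
    have "a \<in> {1..n} \<rightarrow>\<^sub>E {0, 1}"
      using that e by (auto simp: carrier_C2_sym_iff)
    then have "(\<lambda>i\<in>{1..n}. a i mod 2) = a"
      by (intro ext) (auto simp: restrict_def PiE_def Pi_def extensional_def)
    then show ?thesis
      unfolding e one_C2_sym mult_C2_sym by (simp add: inv_id cong: restrict_cong)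
  qed
  show "\<exists>y\<in>carrier ?G. y \<otimes>\<^bsub>?G\<^esub> x = \<one>\<^bsub>?G\<^esub>" if "x \<in> carrier ?G" for x
  proof -
    obtain a s where e: "x = (a, s)"
      by (cases x)
    have s: "s permutes {1..n}" and a: "a \<in> {1..n} \<rightarrow>\<^sub>E {0, 1}"
      using that e by (auto simp: carrier_C2_sym_iff)
    have m: "s i \<in> {1..n}" if "i \<in> {1..n}" for i
      using permutes_in_image[OF s] that by blast
    have ii: "inv_into UNIV (inv_into UNIV s) = s"
      using s by (simp add: permutes_inv_inv)
    \<comment> \<open>The inverse of (a, s) is s^-1 acting on -a, paired with s^-1; in C_2 the minus
      sign disappears.\<close>
    let ?y = "(\<lambda>i\<in>{1..n}. a (s i), inv_into UNIV s)"
    have "?y \<in> carrier ?G"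
      using a m s by (auto simp: carrier_C2_sym_iff permutes_inv)
    moreover have "?y \<otimes>\<^bsub>?G\<^esub> x = \<one>\<^bsub>?G\<^esub>"
      unfolding e one_C2_sym mult_C2_sym ii
      using s by (auto simp: permutes_inv_o intro!: restrict_ext)
    ultimately show ?thesis
      by blast
  qed
qed

text \<open>An abstract K^n with an involution \<open>neg\<close> on K. The instances are bits with
  k \<mapsto> 1 - k and reals with negation, so homomorphism and injectivity are proved once for
  graph automorphisms and Weyl group. \<open>neg_nontrivial\<close> is what makes the signs
  visible.\<close>

locale signed_permutation_rep =
  fixes n :: nat and V :: "'x set" and K :: "'k set" and coord :: "'x \<Rightarrow> nat \<Rightarrow> 'k"
    and make :: "(nat \<Rightarrow> 'k) \<Rightarrow> 'x" and neg :: "'k \<Rightarrow> 'k"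
  assumes coord_in: "x \<in> V \<Longrightarrow> i < n \<Longrightarrow> coord x i \<in> K"
    and make_in: "(\<And>i. i < n \<Longrightarrow> f i \<in> K) \<Longrightarrow> make f \<in> V"
    and coord_make: "i < n \<Longrightarrow> coord (make f) i = f i"
    and coord_eqI: "x \<in> V \<Longrightarrow> y \<in> V \<Longrightarrow> (\<And>i. i < n \<Longrightarrow> coord x i = coord y i) \<Longrightarrow> x = y"
    and neg_in: "k \<in> K \<Longrightarrow> neg k \<in> K"
    and neg_neg: "k \<in> K \<Longrightarrow> neg (neg k) = k"
    and neg_nontrivial: "\<exists>k\<in>K. neg k \<noteq> k"
begin

text \<open>The pair (a, s) permutes by s and then changes signs by a, as in (a, 1)(1, s). Group
  elements use indices 1 to n and coordinates 0 to n - 1, hence \<open>Suc i\<close> and the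
  subtraction of 1.\<close>

definition act :: "(nat \<Rightarrow> int) \<times> (nat \<Rightarrow> nat) \<Rightarrow> 'x \<Rightarrow> 'x" where
  "act g = (\<lambda>x\<in>V. make (\<lambda>i. (if fst g (Suc i) = 0 then id else neg)
                                (coord x (inv_into UNIV (snd g) (Suc i) - 1))))"

lemma inv_Suc:
  assumes "s permutes {1..n}" "i < n"
  shows "inv_into UNIV s (Suc i) - 1 < n" "Suc (inv_into UNIV s (Suc i) - 1) = inv_into UNIV s (Suc i)"
  using permutes_inv_into_mem[OF assms(1), of "Suc i"] assms(2) by auto

lemma act_in:
  assumes "(a, s) \<in> carrier (C2_power_semidirect_sym n)" "x \<in> V"
  shows "act (a, s) x \<in> V"
  using assms inv_Suc(1)[of s] by (auto simp: act_def carrier_C2_sym_iff intro!: make_in neg_in coord_in)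

lemma coord_act:
  assumes "x \<in> V" "i < n"
  shows "coord (act (a, s) x) i =
    (if a (Suc i) = 0 then id else neg) (coord x (inv_into UNIV s (Suc i) - 1))"
  using assms by (simp add: act_def coord_make)

lemma act_mult:
  assumes g: "g \<in> carrier (C2_power_semidirect_sym n)"
    and h: "h \<in> carrier (C2_power_semidirect_sym n)" and x: "x \<in> V"
  shows "act (g \<otimes>\<^bsub>C2_power_semidirect_sym n\<^esub> h) x = act g (act h x)"
proof -
  obtain a s b t where e: "g = (a, s)" "h = (b, t)"
    by (metis surj_pair)
  have s: "s permutes {1..n}" and t: "t permutes {1..n}"
    and a: "a \<in> {1..n} \<rightarrow>\<^sub>E {0, 1}" and b: "b \<in> {1..n} \<rightarrow>\<^sub>E {0, 1}"
    using g h e by (auto simp: carrier_C2_sym_iff)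
  have i: "inv_into UNIV (s \<circ> t) i = inv_into UNIV t (inv_into UNIV s i)" for i
    using s t by (metis comp_apply o_inv_distrib permutes_bij)
  have gh: "g \<otimes>\<^bsub>C2_power_semidirect_sym n\<^esub> h \<in> carrier (C2_power_semidirect_sym n)"
    using g h C2_sym_group[of n] by (simp add: group.is_monoid monoid.m_closed)
  have hx: "act h x \<in> V"
    using act_in h x e by blast
  show ?thesis
  proof (rule coord_eqI)
    show "act (g \<otimes>\<^bsub>C2_power_semidirect_sym n\<^esub> h) x \<in> V"
      using act_in gh x by (metis surj_pair)
    show "act g (act h x) \<in> V"
      using act_in g hx e by blast
    fix k assume k: "k < n"
    let ?j = "inv_into UNIV s (Suc k)"
    let ?c = "coord x (inv_into UNIV t ?j - 1)"
    have j: "?j \<in> {1..n}"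
      using permutes_inv_into_mem[OF s, of "Suc k"] k by auto
    have tj: "inv_into UNIV t ?j \<in> {1..n}"
      using permutes_inv_into_mem[OF t j] .
    have c: "?c \<in> K"
      using tj by (intro coord_in x) auto
    have ab: "a (Suc k) \<in> {0, 1}" "b ?j \<in> {0, 1}"
      using a b j k by (auto simp: PiE_def Pi_def)
    have "coord (act h x) (?j - 1) = (if b ?j = 0 then id else neg) ?c"
      using inv_Suc[OF s k] x unfolding e by (subst coord_act) auto
    then have "coord (act g (act h x)) k =
        (if a (Suc k) = 0 then id else neg) ((if b ?j = 0 then id else neg) ?c)"
      using hx k unfolding e(1) by (subst coord_act) auto
    \<comment> \<open>Two sign changes cancel, which is addition modulo 2 of the exponents.\<close>
    also have "\<dots> = (if (a (Suc k) + b ?j) mod 2 = 0 then id else neg) ?c"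
      using ab c by (auto simp: neg_neg)
    also have "\<dots> = coord (act (g \<otimes>\<^bsub>C2_power_semidirect_sym n\<^esub> h) x) k"
      unfolding e mult_C2_sym by (subst coord_act[OF x k]) (use k i in simp)
    finally show "coord (act (g \<otimes>\<^bsub>C2_power_semidirect_sym n\<^esub> h) x) k = coord (act g (act h x)) k"
      by simp
  qed
qed

lemma act_one:
  assumes "x \<in> V"
  shows "act \<one>\<^bsub>C2_power_semidirect_sym n\<^esub> x = x"
proof (rule coord_eqI)
  show "act \<one>\<^bsub>C2_power_semidirect_sym n\<^esub> x \<in> V"
    unfolding one_C2_sym by (rule act_in) (auto simp: carrier_C2_sym_iff permutes_id assms)
qed (use assms in \<open>auto simp: one_C2_sym coord_act inv_id\<close>)

lemma act_inv:
  assumes g: "g \<in> carrier (C2_power_semidirect_sym n)" and x: "x \<in> V"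
  shows "act (inv\<^bsub>C2_power_semidirect_sym n\<^esub> g) (act g x) = x"
    "act g (act (inv\<^bsub>C2_power_semidirect_sym n\<^esub> g) x) = x"
proof -
  interpret G: group "C2_power_semidirect_sym n"
    by (rule C2_sym_group)
  show "act (inv\<^bsub>C2_power_semidirect_sym n\<^esub> g) (act g x) = x"
    "act g (act (inv\<^bsub>C2_power_semidirect_sym n\<^esub> g) x) = x"
    using g x by (simp_all add: act_mult[symmetric] act_one)
qed

lemma act_Bij:
  assumes g: "g \<in> carrier (C2_power_semidirect_sym n)"
  shows "act g \<in> Bij V"
proof -
  have "inv\<^bsub>C2_power_semidirect_sym n\<^esub> g \<in> carrier (C2_power_semidirect_sym n)"
    using g C2_sym_group by simp
  then have "bij_betw (act g) V V"
    using g act_inv act_in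
    by (intro bij_betw_byWitness[where f' = "act (inv\<^bsub>C2_power_semidirect_sym n\<^esub> g)"])
      (auto, (metis surj_pair)+)
  then show ?thesis
    by (simp add: Bij_def act_def)
qed

lemma act_hom: "act \<in> hom (C2_power_semidirect_sym n) (BijGroup V)"
proof (rule homI)
  fix g h
  assume g: "g \<in> carrier (C2_power_semidirect_sym n)"
    and h: "h \<in> carrier (C2_power_semidirect_sym n)"
  then show "act g \<in> carrier (BijGroup V)"
    by (simp add: BijGroup_def act_Bij)
  have "act (g \<otimes>\<^bsub>C2_power_semidirect_sym n\<^esub> h) = compose V (act g) (act h)"
    using act_mult[OF g h] by (intro ext) (auto simp: compose_def act_def)
  then show "act (g \<otimes>\<^bsub>C2_power_semidirect_sym n\<^esub> h) = act g \<otimes>\<^bsub>BijGroup V\<^esub> act h"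
    using g h by (simp add: BijGroup_def act_Bij)
qed

text \<open>Images of a vector with constant coordinates determine the signs, and those of a vector
  with a single deviating coordinate determine the permutation.\<close>

lemma act_inj: "inj_on act (carrier (C2_power_semidirect_sym n))"
proof (rule inj_onI)
  fix g h
  assume g: "g \<in> carrier (C2_power_semidirect_sym n)"
    and h: "h \<in> carrier (C2_power_semidirect_sym n)" and eq: "act g = act h"
  obtain a s b t where e: "g = (a, s)" "h = (b, t)"
    by (metis surj_pair)
  have s: "s permutes {1..n}" and t: "t permutes {1..n}"
    and a: "a \<in> {1..n} \<rightarrow>\<^sub>E {0, 1}" and b: "b \<in> {1..n} \<rightarrow>\<^sub>E {0, 1}"
    using g h e by (auto simp: carrier_C2_sym_iff)
  obtain k where k: "k \<in> K" "neg k \<noteq> k"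
    using neg_nontrivial by blast
  have ab: "a (Suc i) = b (Suc i)" if i: "i < n" for i
  proof -
    let ?x = "make (\<lambda>_. k)"
    have x: "?x \<in> V"
      using k by (intro make_in)
    have "a (Suc i) \<in> {0, 1}" "b (Suc i) \<in> {0, 1}"
      using a b i by (auto simp: PiE_def Pi_def)
    moreover have "coord (act (a, s) ?x) i = coord (act (b, t) ?x) i"
      using eq e by simp
    ultimately show ?thesis
      using k i x inv_Suc(1)[OF s i] inv_Suc(1)[OF t i]
      by (auto simp: coord_act coord_make split: if_splits)
  qed
  have st: "inv_into UNIV s (Suc i) = inv_into UNIV t (Suc i)" if i: "i < n" for i
  proof -
    let ?f = "\<lambda>j. if j = inv_into UNIV s (Suc i) - 1 then neg k else k"
    let ?x = "make ?f"
    have x: "?x \<in> V"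
      using k neg_in by (intro make_in) auto
    have "coord (act (a, s) ?x) i = coord (act (b, t) ?x) i"
      using eq e by simp
    then have "?f (inv_into UNIV t (Suc i) - 1) = neg k"
      using k i x inv_Suc(1)[OF s i] inv_Suc(1)[OF t i] ab[OF i]
      by (auto simp: coord_act coord_make neg_neg split: if_splits)
    then have "inv_into UNIV s (Suc i) - 1 = inv_into UNIV t (Suc i) - 1"
      using k by (auto split: if_splits)
    then show ?thesis
      using inv_Suc(2)[OF s i] inv_Suc(2)[OF t i] by metis
  qed
  have "inv_into UNIV s j = inv_into UNIV t j" for j
  proof (cases "j \<in> {1..n}")
    case True
    then show ?thesis
      using st[of "j - 1"] by auto
  next
    case False
    then show ?thesis
      using permutes_inv[OF s] permutes_inv[OF t] by (simp add: permutes_not_in)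
  qed
  then have "s = t"
    using s t by (metis ext permutes_inv_inv)
  moreover have "a = b"
  proof (rule PiE_ext[OF a b])
    fix j assume "j \<in> {1..n}"
    then show "a j = b j"
      using ab[of "j - 1"] by auto
  qed
  ultimately show "g = h"
    using e by simp
qed

lemma group_hom_act: "group_hom (C2_power_semidirect_sym n) (BijGroup V) act"
  by (simp add: group_hom_def group_hom_axioms_def C2_sym_group group_BijGroup act_hom)

text \<open>With injectivity known, only the image has to be determined. The target is written with
  a replaced carrier because \<open>graph_aut\<close> and \<open>subgroup_generated\<close> both
  have this form.\<close>

lemma act_iso:
  assumes "act ` carrier (C2_power_semidirect_sym n) = H"
  shows "C2_power_semidirect_sym n \<cong> (BijGroup V)\<lparr>carrier := H\<rparr>"
proof -
  have "act \<in> iso (C2_power_semidirect_sym n) ((BijGroup V)\<lparr>carrier := H\<rparr>)"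
    using act_hom act_inj assms by (auto simp: iso_def hom_def bij_betw_def)
  then show ?thesis
    by (auto simp: is_iso_def)
qed

end

section \<open>Automorphisms of the hypercube graph\<close>

global_interpretation cube: signed_permutation_rep n "cube_vertices n" "{0, 1}"
  "\<lambda>x. x" "\<lambda>f. restrict f {..<n}" "\<lambda>k. 1 - k" for n
  defines cube_act = cube.act
proof (unfold_locales, goal_cases)
  case (4 x y)
  then show ?case
    unfolding cube_vertices_def by (metis PiE_ext lessThan_iff)
qed (auto simp: cube_vertices_def PiE_def Pi_def)

text \<open>Subtraction is truncated, so this is an involution only where the bit is 0 or 1;
  therefore membership in \<open>cube_vertices n\<close> accompanies most facts about it.\<close>

definition flip :: "nat \<Rightarrow> (nat \<Rightarrow> nat) \<Rightarrow> nat \<Rightarrow> nat" where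
  "flip k x = x(k := 1 - x k)"

lemma flip_apply: "flip k x i = (if i = k then 1 - x k else x i)"
  by (simp add: flip_def)

lemma cube_vertex_cases:
  assumes "x \<in> cube_vertices n" "i < n"
  shows "x i = 0 \<or> x i = 1"
  using assms by (auto simp: cube_vertices_def PiE_def Pi_def)

lemma cube_vertices_eqI:
  assumes "x \<in> cube_vertices n" "y \<in> cube_vertices n" "\<And>i. i < n \<Longrightarrow> x i = y i"
  shows "x = y"
  using assms unfolding cube_vertices_def by (metis PiE_ext lessThan_iff)

lemma flip_in: "x \<in> cube_vertices n \<Longrightarrow> k < n \<Longrightarrow> flip k x \<in> cube_vertices n"
  by (auto simp: cube_vertices_def PiE_def Pi_def extensional_def flip_def)

lemma flip_flip: "x \<in> cube_vertices n \<Longrightarrow> k < n \<Longrightarrow> flip k (flip k x) = x"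
  using cube_vertex_cases[of x n k] by (auto simp: flip_def fun_eq_iff)

lemma flip_commute: "flip i (flip j x) = flip j (flip i x)"
  by (auto simp: flip_def fun_eq_iff)

lemma flip_at_neq: "x \<in> cube_vertices n \<Longrightarrow> k < n \<Longrightarrow> flip k x k \<noteq> x k"
  using cube_vertex_cases[of x n k] by (auto simp: flip_def)

lemma flip_inj:
  assumes "x \<in> cube_vertices n" "k < n" "l < n" "flip k x = flip l x"
  shows "k = l"
  using assms flip_at_neq[of x n k] by (metis flip_apply)

lemma cube_adj_iff:
  assumes x: "x \<in> cube_vertices n" and y: "y \<in> cube_vertices n"
  shows "cube_adj n x y \<longleftrightarrow> (\<exists>k<n. y = flip k x)"
proof
  assume "cube_adj n x y"
  then obtain k where k: "{i. i < n \<and> x i \<noteq> y i} = {k}"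
    by (auto simp: cube_adj_def card_1_singleton_iff)
  have d: "i < n \<and> x i \<noteq> y i \<longleftrightarrow> i = k" for i
    using arg_cong[OF k, of "\<lambda>A. i \<in> A"] by simp
  then have kn: "k < n"
    by blast
  have "y = flip k x"
  proof (rule cube_vertices_eqI[OF y flip_in[OF x kn]])
    fix i assume i: "i < n"
    show "y i = flip k x i"
    proof (cases "i = k")
      case True
      then have "x k \<noteq> y k"
        using d by blast
      then show ?thesis
        using True cube_vertex_cases[OF x kn] cube_vertex_cases[OF y kn]
        by (auto simp: flip_apply)
    next
      case False
      then show ?thesis
        using d[of i] i by (auto simp: flip_apply)
    qed
  qed
  then show "\<exists>k<n. y = flip k x"
    using kn by blast
next
  assume "\<exists>k<n. y = flip k x"
  then obtain k where k: "k < n" "y = flip k x"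
    by blast
  then have "{i. i < n \<and> x i \<noteq> y i} = {k}"
    using flip_at_neq[OF x, of k] by (auto simp: flip_apply)
  then show "cube_adj n x y"
    by (simp add: cube_adj_def)
qed

lemma cube_act_in:
  assumes "g \<in> carrier (C2_power_semidirect_sym n)" "x \<in> cube_vertices n"
  shows "cube_act n g x \<in> cube_vertices n"
  using cube.act_in[of "fst g" "snd g" n x] assms by simp

text \<open>Edges in direction k go to edges in direction s k, whatever the signs, because
  complementing a bit commutes with flipping it. Preservation of adjacency and, later, of faces
  comes from here.\<close>

lemma cube_act_flip:
  assumes g: "(a, s) \<in> carrier (C2_power_semidirect_sym n)" and x: "x \<in> cube_vertices n"
    and k: "k < n"
  shows "s (Suc k) - 1 < n"
    and "cube_act n (a, s) (flip k x) = flip (s (Suc k) - 1) (cube_act n (a, s) x)"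
proof -
  have s: "s permutes {1..n}"
    using g by (simp add: carrier_C2_sym_iff)
  have sk: "s (Suc k) \<in> {1..n}"
    using k permutes_in_image[OF s, of "Suc k"] by simp
  then show l: "s (Suc k) - 1 < n"
    by auto
  show "cube_act n (a, s) (flip k x) = flip (s (Suc k) - 1) (cube_act n (a, s) x)"
  proof (rule cube_vertices_eqI)
    show "cube_act n (a, s) (flip k x) \<in> cube_vertices n"
      using cube_act_in[OF g] flip_in[OF x k] .
    show "flip (s (Suc k) - 1) (cube_act n (a, s) x) \<in> cube_vertices n"
      using cube_act_in[OF g x] l by (rule flip_in)
    fix i assume i: "i < n"
    have m: "inv_into UNIV s (Suc i) \<in> {1..n}"
      using permutes_inv_into_mem[OF s, of "Suc i"] i by auto
    have "inv_into UNIV s (Suc i) - 1 = k \<longleftrightarrow> inv_into UNIV s (Suc i) = Suc k"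
      using m by auto
    also have "\<dots> \<longleftrightarrow> Suc i = s (Suc k)"
      using s by (metis permutes_inverses)
    also have "\<dots> \<longleftrightarrow> i = s (Suc k) - 1"
      using sk by auto
    finally have eq: "inv_into UNIV s (Suc i) - 1 = k \<longleftrightarrow> i = s (Suc k) - 1" .
    have "x (inv_into UNIV s (Suc i) - 1) = 0 \<or> x (inv_into UNIV s (Suc i) - 1) = 1"
      using m by (intro cube_vertex_cases[OF x]) auto
    then show "cube_act n (a, s) (flip k x) i = flip (s (Suc k) - 1) (cube_act n (a, s) x) i"
      using eq i x k flip_in[OF x k]
      by (simp add: cube.coord_act flip_apply) (auto simp: flip_apply)
  qed
qed

lemma graph_aut_carrier_iff:
  "f \<in> carrier (graph_aut V adj) \<longleftrightarrow>
     f \<in> Bij V \<and> (\<forall>x\<in>V. \<forall>y\<in>V. adj (f x) (f y) \<longleftrightarrow> adj x y)"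
  by (simp add: graph_aut_def)

lemma cube_autD:
  assumes "f \<in> carrier (cube_aut n)"
  shows "f \<in> Bij (cube_vertices n)" "inj_on f (cube_vertices n)"
    and "x \<in> cube_vertices n \<Longrightarrow> f x \<in> cube_vertices n"
    and "x \<in> cube_vertices n \<Longrightarrow> y \<in> cube_vertices n \<Longrightarrow>
      cube_adj n (f x) (f y) \<longleftrightarrow> cube_adj n x y"
proof -
  show *: "f \<in> Bij (cube_vertices n)"
    using assms by (simp add: cube_aut_def graph_aut_carrier_iff)
  show "inj_on f (cube_vertices n)"
    using * by (simp add: Bij_def bij_betw_def)
  show "x \<in> cube_vertices n \<Longrightarrow> f x \<in> cube_vertices n"
    using Bij_imp_funcset[OF *] by blast
  show "x \<in> cube_vertices n \<Longrightarrow> y \<in> cube_vertices n \<Longrightarrow>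
      cube_adj n (f x) (f y) \<longleftrightarrow> cube_adj n x y"
    using assms by (simp add: cube_aut_def graph_aut_carrier_iff)
qed

lemma cube_act_adj:
  assumes g: "g \<in> carrier (C2_power_semidirect_sym n)"
    and "x \<in> cube_vertices n" "y \<in> cube_vertices n" "cube_adj n x y"
  shows "cube_adj n (cube_act n g x) (cube_act n g y)"
proof -
  obtain a s where e: "g = (a, s)"
    by (cases g)
  obtain k where k: "k < n" "y = flip k x"
    using assms by (auto simp: cube_adj_iff)
  have "cube_act n g y = flip (s (Suc k) - 1) (cube_act n g x)" "s (Suc k) - 1 < n"
    using cube_act_flip[of a s n x k] assms(1,2) k unfolding e by simp_all
  then show ?thesis
    using cube_adj_iff[of "cube_act n g x" n "cube_act n g y"] cube_act_in[OF g] assms(2,3) by blast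
qed

text \<open>Adjacency is also reflected, because the inverse group element preserves it.\<close>

lemma cube_act_aut:
  assumes g: "g \<in> carrier (C2_power_semidirect_sym n)"
  shows "cube_act n g \<in> carrier (cube_aut n)"
proof -
  have i: "inv\<^bsub>C2_power_semidirect_sym n\<^esub> g \<in> carrier (C2_power_semidirect_sym n)"
    using g C2_sym_group by simp
  have "cube_adj n x y"
    if "x \<in> cube_vertices n" "y \<in> cube_vertices n"
      "cube_adj n (cube_act n g x) (cube_act n g y)" for x y
    using cube_act_adj[OF i _ _ that(3)] cube.act_inv(1)[OF g] cube_act_in[OF g] that
    by simp
  then show ?thesis
    using cube.act_Bij[OF g] cube_act_adj[OF g]
    by (auto simp: cube_aut_def graph_aut_carrier_iff)
qed

text \<open>Write y as flip c of one neighbour of w and flip d of the other. As y \<noteq> w, bit a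
  of y differs from that of w, which only d = a can explain if c \<noteq> b; but then bit c differs
  on one side alone. So c = b.\<close>

lemma common_neighbour_unique:
  assumes w: "w \<in> cube_vertices n" and ab: "a < n" "b < n" "a \<noteq> b"
    and y: "y \<in> cube_vertices n" "y \<noteq> w"
    and "cube_adj n (flip a w) y" "cube_adj n (flip b w) y"
  shows "y = flip b (flip a w)"
proof -
  have v: "flip a w \<in> cube_vertices n" "flip b w \<in> cube_vertices n"
    using w ab by (auto intro: flip_in)
  obtain c where c: "c < n" "y = flip c (flip a w)"
    using assms(7) cube_adj_iff[OF v(1) y(1)] by blast
  obtain d where d: "d < n" "y = flip d (flip b w)"
    using assms(8) cube_adj_iff[OF v(2) y(1)] by blast
  have "c \<noteq> a"
    using c y flip_flip[OF w] ab by metis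
  have "c = b"
  proof (rule ccontr)
    assume "c \<noteq> b"
    have "flip c (flip a w) a \<noteq> w a"
      using flip_at_neq[OF w ab(1)] \<open>c \<noteq> a\<close> by (simp add: flip_apply)
    then have "d = a"
      using c d ab by (metis flip_apply)
    have "flip c (flip a w) c \<noteq> w c"
      using flip_at_neq[OF w c(1)] \<open>c \<noteq> a\<close> by (simp add: flip_apply)
    moreover have "flip d (flip b w) c = w c"
      using \<open>d = a\<close> \<open>c \<noteq> a\<close> \<open>c \<noteq> b\<close> by (simp add: flip_apply)
    ultimately show False
      using c d by simp
  qed
  then show ?thesis
    using c by simp
qed

section \<open>Rigidity of automorphisms and surjectivity of the signed permutations\<close>

definition cube_zero :: "nat \<Rightarrow> nat \<Rightarrow> nat" where
  "cube_zero n = (\<lambda>i\<in>{..<n}. 0)"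

lemma cube_zero_in: "cube_zero n \<in> cube_vertices n"
  by (simp add: cube_zero_def cube_vertices_def)

text \<open>A vertex of weight at least 2 is one of the only two common neighbours of two vertices of
  smaller weight, and the other one has smaller weight still.\<close>

lemma cube_aut_eqI:
  assumes f: "f \<in> carrier (cube_aut n)" and g: "g \<in> carrier (cube_aut n)"
    and zero: "f (cube_zero n) = g (cube_zero n)"
    and unit: "\<And>k. k < n \<Longrightarrow> f (flip k (cube_zero n)) = g (flip k (cube_zero n))"
  shows "f = g"
proof -
  note fB = cube_autD(1)[OF f] and fin = cube_autD(3)[OF f] and finj = cube_autD(2)[OF f]
    and fadj = cube_autD(4)[OF f]
  note gB = cube_autD(1)[OF g] and gin = cube_autD(3)[OF g] and ginj = cube_autD(2)[OF g]
    and gadj = cube_autD(4)[OF g]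
  have "f x = g x" if "x \<in> cube_vertices n" for x
    using that
  proof (induction "card {i. i < n \<and> x i = 1}" arbitrary: x rule: less_induct)
    case less
    note x = \<open>x \<in> cube_vertices n\<close>
    let ?S = "{i. i < n \<and> x i = 1}"
    \<comment> \<open>Stated for every y supported inside the support of x, since it is needed for x
      itself and for \<open>flip i x\<close>.\<close>
    have down: "f (flip i y) = g (flip i y)"
      if "i < n" "y i = 1" "y \<in> cube_vertices n"
        "{i. i < n \<and> y i = 1} \<subseteq> ?S" for i y
    proof (rule less.hyps)
      have "{j. j < n \<and> flip i y j = 1} \<subseteq> {j. j < n \<and> y j = 1} - {i}"
        using that(2) by (auto simp: flip_apply)
      then have "{j. j < n \<and> flip i y j = 1} \<subset> ?S"
        using that(1,2,4) by blast
      then show "card {j. j < n \<and> flip i y j = 1} < card ?S"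
        by (intro psubset_card_mono) auto
      show "flip i y \<in> cube_vertices n"
        using that by (intro flip_in)
    qed
    consider "?S = {}" | i where "?S = {i}" | i j where "i \<in> ?S" "j \<in> ?S" "i \<noteq> j"
      by blast
    then show ?case
    proof cases
      case 1
      then have "x = cube_zero n"
        using cube_vertex_cases[OF x]
        by (intro cube_vertices_eqI[OF x cube_zero_in]) (auto simp: cube_zero_def)
      then show ?thesis
        using zero by simp
    next
      case (2 i)
      then have "i < n"
        by auto
      have "x = flip i (cube_zero n)"
      proof (rule cube_vertices_eqI[OF x flip_in[OF cube_zero_in \<open>i < n\<close>]])
        fix j assume "j < n"
        then show "x j = flip i (cube_zero n) j"
          using 2 cube_vertex_cases[OF x, of j] by (auto simp: cube_zero_def flip_apply)
      qed
      then show ?thesis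
        using unit \<open>i < n\<close> by simp
    next
      case (3 i j)
      then have ij: "i < n" "j < n" "x i = 1" "x j = 1"
        by auto
      let ?w = "flip j (flip i x)"
      have v: "flip i x \<in> cube_vertices n" "flip j x \<in> cube_vertices n" "?w \<in> cube_vertices n"
        using x ij by (auto intro!: flip_in)
      have eq: "f (flip i x) = g (flip i x)" "f (flip j x) = g (flip j x)"
        using down[of i x] down[of j x] ij x by auto
      have eqw: "f ?w = g ?w"
        using v ij 3 by (intro down) (auto simp: flip_apply split: if_splits)
      have wx: "?w \<noteq> x"
        using ij 3(3) by (auto simp: fun_eq_iff flip_apply intro!: exI[of _ j])
      have e: "flip j ?w = flip i x" "flip i ?w = flip j x"
        using flip_flip[OF v(1) ij(2)] flip_flip[OF v(2) ij(1)] flip_commute by metis+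
      have wadj: "cube_adj n ?w (flip i x)" "cube_adj n ?w (flip j x)"
        using v ij e by (metis cube_adj_iff)+
      have xadj: "cube_adj n (flip i x) x" "cube_adj n (flip j x) x"
        using v ij x flip_flip[OF x] by (metis cube_adj_iff)+
      obtain a where a: "a < n" "g (flip i x) = flip a (g ?w)"
        using wadj(1) gadj gin v by (metis cube_adj_iff)
      obtain b where b: "b < n" "g (flip j x) = flip b (g ?w)"
        using wadj(2) gadj gin v by (metis cube_adj_iff)
      have "flip i x \<noteq> flip j x"
        using flip_inj[OF x] ij 3(3) by blast
      then have "a \<noteq> b"
        using a b v ginj by (metis inj_onD)
      have "f x \<noteq> f ?w" "g x \<noteq> g ?w"
        using wx x v finj ginj by (metis inj_onD)+
      then have "f x \<noteq> g ?w"
        using eqw by simp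
      have "cube_adj n (flip a (g ?w)) (f x)" "cube_adj n (flip b (g ?w)) (f x)"
        using xadj fadj v x eq a(2) b(2) by metis+
      then have "f x = flip b (flip a (g ?w))"
        using common_neighbour_unique[OF gin[OF v(3)] a(1) b(1) \<open>a \<noteq> b\<close> fin[OF x] \<open>f x \<noteq> g ?w\<close>]
        by blast
      moreover have "cube_adj n (flip a (g ?w)) (g x)" "cube_adj n (flip b (g ?w)) (g x)"
        using xadj gadj v x a(2) b(2) by metis+
      then have "g x = flip b (flip a (g ?w))"
        using common_neighbour_unique[OF gin[OF v(3)] a(1) b(1) \<open>a \<noteq> b\<close> gin[OF x] \<open>g x \<noteq> g ?w\<close>]
        by blast
      ultimately show ?thesis
        by simp
    qed
  qed
  then show ?thesis
    using fB gB by (intro extensionalityI[of _ "cube_vertices n"]) (auto simp: Bij_def)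
qed

text \<open>An automorphism permutes the n directions at the zero vertex. This permutation and the
  image of zero define a signed permutation that agrees with it at zero and on the neighbours of
  zero, hence everywhere by \<open>cube_aut_eqI\<close>.\<close>

lemma cube_act_image: "cube_act n ` carrier (C2_power_semidirect_sym n) = carrier (cube_aut n)"
proof
  show "cube_act n ` carrier (C2_power_semidirect_sym n) \<subseteq> carrier (cube_aut n)"
    using cube_act_aut by blast
  show "carrier (cube_aut n) \<subseteq> cube_act n ` carrier (C2_power_semidirect_sym n)"
  proof
    fix f assume f: "f \<in> carrier (cube_aut n)"
    note fin = cube_autD(3)[OF f] and finj = cube_autD(2)[OF f] and fadj = cube_autD(4)[OF f]
    let ?z = "cube_zero n"
    have fz: "f ?z \<in> cube_vertices n"
      using fin cube_zero_in by blast
    have "\<exists>l<n. f (flip k ?z) = flip l (f ?z)" if "k < n" for k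
    proof -
      have "cube_adj n (f ?z) (f (flip k ?z))"
        using that fadj flip_in[OF cube_zero_in] cube_zero_in by (metis cube_adj_iff)
      then show ?thesis
        using that fin flip_in[OF cube_zero_in] cube_zero_in by (metis cube_adj_iff)
    qed
    then obtain p where p: "\<And>k. k < n \<Longrightarrow> p k < n \<and> f (flip k ?z) = flip (p k) (f ?z)"
      by metis
    have p_inj: "inj_on p {..<n}"
    proof (rule inj_onI)
      fix k l assume kl: "k \<in> {..<n}" "l \<in> {..<n}" "p k = p l"
      then have "f (flip k ?z) = f (flip l ?z)"
        using p by simp
      then have "flip k ?z = flip l ?z"
        using finj kl flip_in[OF cube_zero_in] by (auto dest: inj_onD)
      then show "k = l"
        using flip_inj[OF cube_zero_in] kl by blast
    qed
    define s where "s = (\<lambda>i. if i \<in> {1..n} then Suc (p (i - 1)) else i)"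
    have s: "s permutes {1..n}"
      unfolding s_def using p by (intro permutes_shift p_inj) auto
    \<comment> \<open>A signed permutation maps the zero vertex to its own sign vector, so the signs
      can be read off from the image of zero.\<close>
    define a where "a = (\<lambda>i\<in>{1..n}. int (f ?z (i - 1)))"
    have g: "(a, s) \<in> carrier (C2_power_semidirect_sym n)"
    proof -
      have "int (f ?z (i - 1)) \<in> {0, 1}" if "i \<in> {1..n}" for i
        using cube_vertex_cases[OF fz, of "i - 1"] that by auto
      then show ?thesis
        using s by (auto simp: carrier_C2_sym_iff a_def)
    qed
    have z: "cube_act n (a, s) ?z = f ?z"
    proof (rule cube_vertices_eqI[OF cube_act_in[OF g cube_zero_in] fz])
      fix i assume i: "i < n"
      have "inv_into UNIV s (Suc i) - 1 < n"
        using cube.inv_Suc(1)[OF s i] .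
      then show "cube_act n (a, s) ?z i = f ?z i"
        using i cube_vertex_cases[OF fz i] cube_zero_in
        by (auto simp: cube.coord_act a_def) (auto simp: cube_zero_def)
    qed
    have "f = cube_act n (a, s)"
    proof (rule cube_aut_eqI[OF f cube_act_aut[OF g]])
      show "f ?z = cube_act n (a, s) ?z"
        using z by simp
      fix k assume k: "k < n"
      have "s (Suc k) - 1 = p k"
        using k by (simp add: s_def)
      then show "f (flip k ?z) = cube_act n (a, s) (flip k ?z)"
        using cube_act_flip(2)[OF g cube_zero_in k] p[OF k] z by simp
    qed
    then show "f \<in> cube_act n ` carrier (C2_power_semidirect_sym n)"
      using g by blast
  qed
qed

theorem C2_sym_iso_cube_aut: "C2_power_semidirect_sym n \<cong> cube_aut n"
  using cube.act_iso[OF cube_act_image[of n]] by (simp add: cube_aut_def graph_aut_def)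

section \<open>The toroidal grid as a hypercube graph\<close>

lemma exhaust_mod4: "t = 0 \<or> t = 1 \<or> t = 2 \<or> t = (3 :: 4)"
proof (induct t)
  case (of_int z)
  then have "z = 0 \<or> z = 1 \<or> z = 2 \<or> z = 3"
    by auto
  then show ?case
    by auto
qed

lemma UNIV_mod4: "(UNIV :: 4 set) = {0, 1, 2, 3}"
  using exhaust_mod4 by blast

text \<open>The 4-cycle seen as a square based at s: the images of s under the two reflections are
  its neighbours, and s + 2, the image under their composite, is opposite.\<close>

lemma sum_mod4:
  fixes f :: "4 \<Rightarrow> 'a :: comm_monoid_add"
  shows "(\<Sum>t\<in>UNIV. f t) = f s + f (1 - s) + f (- 1 - s) + f (s + 2)"
proof -
  have m: "- 1 = (3 :: 4)" "- 2 = (2 :: 4)" "- 3 = (1 :: 4)" "- 4 = (0 :: 4)" "4 = (0 :: 4)" "5 = (1 :: 4)"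
    by simp_all
  then show ?thesis
    using exhaust_mod4[of s] unfolding UNIV_mod4 by (auto simp: m ac_simps)
qed

text \<open>The Gray code \<open>0, 1, 2, 3 \<mapsto> 00, 10, 11, 01\<close> identifies the 4-cycle with the square. The
  two coordinate flips of the square become \<open>t \<mapsto> 1 - t\<close> and \<open>t \<mapsto> - 1 - t\<close>, and
  the antipodal map becomes \<open>t \<mapsto> t + 2\<close>.\<close>

definition gray :: "nat \<Rightarrow> 4 \<Rightarrow> nat" where
  "gray e t = (if e = 0 then (if t \<in> {1, 2} then 1 else 0) else (if t \<in> {2, 3} then 1 else 0))"

definition torus_code :: "nat \<Rightarrow> (nat \<Rightarrow> 4) \<Rightarrow> nat \<Rightarrow> nat" where
  "torus_code m p = (\<lambda>k\<in>{..<2 * m}. gray (k mod 2) (p (k div 2)))"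

definition torus_flip :: "nat \<Rightarrow> (nat \<Rightarrow> 4) \<Rightarrow> nat \<Rightarrow> 4" where
  "torus_flip k p = p(k div 2 := (if even k then 1 - p (k div 2) else - 1 - p (k div 2)))"

definition torus_antipode :: "nat \<Rightarrow> (nat \<Rightarrow> 4) \<Rightarrow> nat \<Rightarrow> 4" where
  "torus_antipode m p = (\<lambda>i\<in>{..<m}. p i + 2)"

definition cube_antipode :: "nat \<Rightarrow> (nat \<Rightarrow> nat) \<Rightarrow> nat \<Rightarrow> nat" where
  "cube_antipode n x = (\<lambda>i\<in>{..<n}. 1 - x i)"

lemma gray_inj: "gray 0 s = gray 0 t \<Longrightarrow> gray 1 s = gray 1 t \<Longrightarrow> s = t"
  using exhaust_mod4[of s] exhaust_mod4[of t] by (auto simp: gray_def)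

lemma positions_upd: "p \<in> positions m \<Longrightarrow> i < m \<Longrightarrow> p(i := t) \<in> positions m"
  by (auto simp: positions_def PiE_def extensional_def)

lemma torus_flip_in: "p \<in> positions m \<Longrightarrow> k < 2 * m \<Longrightarrow> torus_flip k p \<in> positions m"
  by (auto simp: torus_flip_def intro!: positions_upd)

lemma torus_antipode_in: "torus_antipode m p \<in> positions m"
  by (auto simp: torus_antipode_def positions_def)

lemma torus_code_in: "torus_code m p \<in> cube_vertices (2 * m)"
  by (auto simp: torus_code_def cube_vertices_def gray_def)

lemma torus_code_flip:
  assumes "k < 2 * m"
  shows "torus_code m (torus_flip k p) = flip k (torus_code m p)"
proof
  fix l
  have e: "gray 0 (1 - t) = 1 - gray 0 t" "gray (Suc 0) (1 - t) = gray (Suc 0) t"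
    "gray 0 (- 1 - t) = gray 0 t" "gray (Suc 0) (- 1 - t) = 1 - gray (Suc 0) t" for t
    using exhaust_mod4[of t] by (auto simp: gray_def)
  show "torus_code m (torus_flip k p) l = flip k (torus_code m p) l"
  proof (cases "l < 2 * m \<and> l div 2 = k div 2")
    case True
    let ?t = "p (k div 2)"
    have lk: "l = k \<longleftrightarrow> l mod 2 = k mod 2"
      using True by (metis div_mult_mod_eq)
    have L: "torus_code m (torus_flip k p) l = gray (l mod 2) (if even k then 1 - ?t else - 1 - ?t)"
      using True by (simp add: torus_code_def torus_flip_def)
    have R: "flip k (torus_code m p) l = (if l = k then 1 - gray (l mod 2) ?t else gray (l mod 2) ?t)"
      using True assms by (simp add: torus_code_def flip_apply)
    have "k mod 2 = 0 \<or> k mod 2 = 1" "l mod 2 = 0 \<or> l mod 2 = 1"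
      by auto
    then show ?thesis
      unfolding L R lk by (elim disjE) (simp_all add: e even_iff_mod_2_eq_zero)
  next
    case False
    then show ?thesis
      using assms by (auto simp: torus_code_def torus_flip_def flip_apply)
  qed
qed

lemma torus_code_antipode:
  "torus_code m (torus_antipode m p) = cube_antipode (2 * m) (torus_code m p)"
proof
  fix l
  have e: "gray c (t + 2) = 1 - gray c t" for c t
    using exhaust_mod4[of t] by (auto simp: gray_def)
  show "torus_code m (torus_antipode m p) l = cube_antipode (2 * m) (torus_code m p) l"
    by (auto simp: torus_code_def torus_antipode_def cube_antipode_def e)
qed

text \<open>Two bits determine each coordinate, and 4^m = 2^(2 m), so injectivity suffices.\<close>

lemma torus_code_bij: "bij_betw (torus_code m) (positions m) (cube_vertices (2 * m))"
proof -
  have inj: "inj_on (torus_code m) (positions m)"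
  proof (rule inj_onI)
    fix p q assume p: "p \<in> positions m" and q: "q \<in> positions m"
      and eq: "torus_code m p = torus_code m q"
    show "p = q"
    proof (rule PiE_ext)
      show "p \<in> {..<m} \<rightarrow>\<^sub>E UNIV" "q \<in> {..<m} \<rightarrow>\<^sub>E UNIV"
        using p q by (auto simp: positions_def)
      fix i assume "i \<in> {..<m}"
      then show "p i = q i"
        using fun_cong[OF eq, of "2 * i"] fun_cong[OF eq, of "2 * i + 1"]
        by (intro gray_inj) (auto simp: torus_code_def)
    qed
  qed
  have fin: "finite (cube_vertices (2 * m))"
    by (auto simp: cube_vertices_def intro!: finite_PiE)
  have "card (positions m) = card (cube_vertices (2 * m))"
    by (simp add: positions_def cube_vertices_def card_PiE power_mult numeral_2_eq_2[symmetric])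
  then have "torus_code m ` positions m = cube_vertices (2 * m)"
    using inj fin by (intro card_subset_eq) (auto simp: card_image torus_code_in)
  then show ?thesis
    using inj by (simp add: bij_betw_def)
qed

text \<open>The edges of the 4-cycle form two perfect matchings: t \<mapsto> 1 - t swaps the ends of
  {0, 1} and {2, 3}, while t \<mapsto> - 1 - t swaps those of {1, 2} and {3, 0}. They are the two
  edge directions of the square.\<close>

lemma cycle4_adj_iff: "cycle4_adj s t \<longleftrightarrow> t = 1 - s \<or> t = - 1 - s"
  using exhaust_mod4[of s] exhaust_mod4[of t] unfolding cycle4_adj_def
  by (elim disjE) simp_all

lemma torus_adj_iff:
  assumes p: "p \<in> positions m" and q: "q \<in> positions m"
  shows "torus_adj m p q \<longleftrightarrow> (\<exists>k<2 * m. q = torus_flip k p)"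
proof
  {
    assume "torus_adj m p q"
    then obtain i where i: "i < m" "q i = 1 - p i \<or> q i = - 1 - p i"
      "\<forall>j<m. j \<noteq> i \<longrightarrow> p j = q j"
      unfolding torus_adj_def cycle4_adj_iff by blast
    have e: "q = p(i := q i)"
    proof (rule PiE_ext)
      show "q \<in> {..<m} \<rightarrow>\<^sub>E UNIV" "p(i := q i) \<in> {..<m} \<rightarrow>\<^sub>E UNIV"
        using q positions_upd[OF p i(1)] by (simp_all add: positions_def)
      fix j assume "j \<in> {..<m}"
      then show "q j = (p(i := q i)) j"
        using i(3) by (cases "j = i") auto
    qed
    from i(2) show "\<exists>k<2 * m. q = torus_flip k p"
    proof
      assume "q i = 1 - p i"
      then have "p(i := q i) = torus_flip (2 * i) p"
        by (simp add: torus_flip_def)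
      then show ?thesis
        using i(1) e by (metis mult_less_cancel1 zero_less_numeral)
    next
      assume "q i = - 1 - p i"
      then have "p(i := q i) = torus_flip (2 * i + 1) p"
        by (simp add: torus_flip_def)
      moreover have "2 * i + 1 < 2 * m"
        using i(1) by simp
      ultimately show ?thesis
        using e by metis
    qed
  }
  assume "\<exists>k<2 * m. q = torus_flip k p"
  then obtain k where k: "k < 2 * m" "q = torus_flip k p"
    by blast
  have "q (k div 2) = 1 - p (k div 2) \<or> q (k div 2) = - 1 - p (k div 2)"
    "\<forall>j<m. j \<noteq> k div 2 \<longrightarrow> p j = q j"
    unfolding k(2) by (simp_all add: torus_flip_def)
  moreover have "k div 2 < m"
    using k(1) by auto
  ultimately show "torus_adj m p q"
    unfolding torus_adj_def cycle4_adj_iff by blast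
qed

lemma torus_code_adj:
  assumes p: "p \<in> positions m" and q: "q \<in> positions m"
  shows "cube_adj (2 * m) (torus_code m p) (torus_code m q) \<longleftrightarrow> torus_adj m p q"
proof -
  have "torus_code m q = torus_code m (torus_flip k p) \<longleftrightarrow> q = torus_flip k p" if "k < 2 * m" for k
    using torus_code_bij[of m] q torus_flip_in[OF p that] by (auto simp: bij_betw_def dest: inj_onD)
  then show ?thesis
    unfolding torus_adj_iff[OF p q] cube_adj_iff[OF torus_code_in torus_code_in]
    using torus_code_flip by metis
qed

section \<open>Automorphism groups of graphs and conjugation by graph isomorphisms\<close>

lemma graph_aut_subgroup: "subgroup (carrier (graph_aut V adj)) (BijGroup V)"
proof -
  interpret B: group "BijGroup V"
    by (rule group_BijGroup)
  show ?thesis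
  proof (rule B.subgroupI)
    show "carrier (graph_aut V adj) \<subseteq> carrier (BijGroup V)"
      by (auto simp: graph_aut_def BijGroup_def)
    have "(\<lambda>x\<in>V. x) \<in> carrier (graph_aut V adj)"
      by (simp add: graph_aut_carrier_iff id_Bij)
    then show "carrier (graph_aut V adj) \<noteq> {}"
      by blast
    fix f assume f: "f \<in> carrier (graph_aut V adj)"
    then have fB: "f \<in> Bij V"
      by (simp add: graph_aut_carrier_iff)
    have ff: "f (inv_into V f x) = x" "inv_into V f x \<in> V" if "x \<in> V" for x
      using fB that by (auto simp: Bij_def bij_betw_def f_inv_into_f inv_into_into)
    have "adj (inv_into V f x) (inv_into V f y) \<longleftrightarrow> adj x y" if "x \<in> V" "y \<in> V" for x y
      using f ff[OF that(1)] ff[OF that(2)] by (metis graph_aut_carrier_iff)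
    then show "inv\<^bsub>BijGroup V\<^esub> f \<in> carrier (graph_aut V adj)"
      using fB by (simp add: graph_aut_carrier_iff inv_BijGroup restrict_inv_into_Bij)
    fix g assume g: "g \<in> carrier (graph_aut V adj)"
    then have gB: "g \<in> Bij V"
      by (simp add: graph_aut_carrier_iff)
    then have "g x \<in> V" if "x \<in> V" for x
      using that Bij_imp_funcset by blast
    then show "f \<otimes>\<^bsub>BijGroup V\<^esub> g \<in> carrier (graph_aut V adj)"
      using f g fB gB by (simp add: graph_aut_carrier_iff BijGroup_def compose_Bij compose_eq)
  qed
qed

lemma graph_aut_group: "group (graph_aut V adj)"
  using group.subgroup_imp_group[OF group_BijGroup graph_aut_subgroup[of V adj]]
  by (simp add: graph_aut_def)

lemma graph_aut_mult:
  assumes "f \<in> carrier (graph_aut V adj)" "g \<in> carrier (graph_aut V adj)"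
  shows "f \<otimes>\<^bsub>graph_aut V adj\<^esub> g = compose V f g"
  using assms by (simp add: graph_aut_def BijGroup_def)

text \<open>Pulling an automorphism back along a graph isomorphism. Besides giving the isomorphism
  of the groups, it moves single automorphisms between grid and cube when the hypercubes are
  compared.\<close>

lemma graph_aut_conj:
  assumes \<psi>: "bij_betw \<psi> V W"
    and adj: "\<And>x y. x \<in> V \<Longrightarrow> y \<in> V \<Longrightarrow> adj' (\<psi> x) (\<psi> y) \<longleftrightarrow> adj x y"
    and f: "f \<in> carrier (graph_aut W adj')"
  shows "(\<lambda>x\<in>V. inv_into V \<psi> (f (\<psi> x))) \<in> carrier (graph_aut V adj)"
proof -
  have f': "bij_betw f W W" and fadj: "\<And>x y. x \<in> W \<Longrightarrow> y \<in> W \<Longrightarrow> adj' (f x) (f y) \<longleftrightarrow> adj' x y"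
    using f by (auto simp: graph_aut_carrier_iff Bij_def)
  have "bij_betw (inv_into V \<psi> \<circ> (f \<circ> \<psi>)) V V"
    using \<psi> f' by (intro bij_betw_trans[of _ _ W] bij_betw_inv_into)
  then have B: "bij_betw (\<lambda>x\<in>V. inv_into V \<psi> (f (\<psi> x))) V V"
    by (rule bij_betw_cong[THEN iffD1, rotated]) simp
  have in': "f (\<psi> x) \<in> W" "\<psi> x \<in> W" if "x \<in> V" for x
    using that \<psi> f' by (auto simp: bij_betw_def)
  have i: "\<psi> (inv_into V \<psi> (f (\<psi> x))) = f (\<psi> x)" "inv_into V \<psi> (f (\<psi> x)) \<in> V" if "x \<in> V" for x
    using in'[OF that] \<psi> by (auto simp: bij_betw_def f_inv_into_f inv_into_into)
  have "adj (inv_into V \<psi> (f (\<psi> x))) (inv_into V \<psi> (f (\<psi> y))) \<longleftrightarrow> adj x y"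
    if "x \<in> V" "y \<in> V" for x y
    using adj[OF i(2)[OF that(1)] i(2)[OF that(2)]] i(1) fadj in' adj that by simp
  then show ?thesis
    using B by (simp add: graph_aut_carrier_iff Bij_def)
qed

lemma graph_aut_iso:
  assumes \<psi>: "bij_betw \<psi> V W"
    and adj: "\<And>x y. x \<in> V \<Longrightarrow> y \<in> V \<Longrightarrow> adj' (\<psi> x) (\<psi> y) \<longleftrightarrow> adj x y"
  shows "graph_aut W adj' \<cong> graph_aut V adj"
proof -
  define \<Psi> where "\<Psi> = (\<lambda>f. \<lambda>x\<in>V. inv_into V \<psi> (f (\<psi> x)))"
  have \<Psi>_in: "\<Psi> f \<in> carrier (graph_aut V adj)" if "f \<in> carrier (graph_aut W adj')" for f
    unfolding \<Psi>_def using \<psi> adj that by (rule graph_aut_conj)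
  define \<phi> where "\<phi> = inv_into V \<psi>"
  have \<phi>: "bij_betw \<phi> W V"
    unfolding \<phi>_def using \<psi> by (rule bij_betw_inv_into)
  have \<phi>\<psi>: "\<phi> (\<psi> x) = x" "\<psi> x \<in> W" if "x \<in> V" for x
    using \<psi> that by (auto simp: \<phi>_def bij_betw_def)
  have \<psi>\<phi>: "\<psi> (\<phi> y) = y" "\<phi> y \<in> V" if "y \<in> W" for y
    using \<psi> that by (auto simp: \<phi>_def bij_betw_def f_inv_into_f inv_into_into)
  \<comment> \<open>Conjugation by \<phi> inverts \<Psi>; \<open>graph_aut_conj\<close> delivers it
    with \<open>inv_into W \<phi>\<close>, which has to be recognised as \<psi> on V.\<close>
  have \<psi>_eq: "inv_into W \<phi> x = \<psi> x" if "x \<in> V" for x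
    using \<phi> \<phi>\<psi>[OF that] that by (intro inv_into_f_eq) (auto simp: bij_betw_def)
  have adj': "adj (\<phi> x) (\<phi> y) \<longleftrightarrow> adj' x y" if "x \<in> W" "y \<in> W" for x y
    using adj[of "\<phi> x" "\<phi> y"] \<psi>\<phi> that by simp
  have carrierW: "f \<in> extensional W" "\<And>x. x \<in> W \<Longrightarrow> f x \<in> W" if "f \<in> carrier (graph_aut W adj')" for f
    using that Bij_imp_funcset[of f W] by (auto simp: graph_aut_carrier_iff Bij_def)
  have carrierV: "f \<in> extensional V" "\<And>x. x \<in> V \<Longrightarrow> f x \<in> V" if "f \<in> carrier (graph_aut V adj)" for f
    using that Bij_imp_funcset[of f V] by (auto simp: graph_aut_carrier_iff Bij_def)
  have "bij_betw \<Psi> (carrier (graph_aut W adj')) (carrier (graph_aut V adj))"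
  proof (rule bij_betw_byWitness[where f' = "\<lambda>g. \<lambda>y\<in>W. \<psi> (g (\<phi> y))"])
    show "\<forall>f\<in>carrier (graph_aut W adj'). (\<lambda>y\<in>W. \<psi> (\<Psi> f (\<phi> y))) = f"
    proof
      fix f assume f: "f \<in> carrier (graph_aut W adj')"
      show "(\<lambda>y\<in>W. \<psi> (\<Psi> f (\<phi> y))) = f"
        using carrierW[OF f] \<psi>\<phi>
        by (intro extensionalityI[of _ W]) (auto simp: \<Psi>_def \<phi>_def[symmetric])
    qed
    show "\<forall>g\<in>carrier (graph_aut V adj). \<Psi> (\<lambda>y\<in>W. \<psi> (g (\<phi> y))) = g"
    proof
      fix g assume g: "g \<in> carrier (graph_aut V adj)"
      show "\<Psi> (\<lambda>y\<in>W. \<psi> (g (\<phi> y))) = g"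
        using carrierV[OF g] \<phi>\<psi>
        by (intro extensionalityI[of _ V]) (auto simp: \<Psi>_def \<phi>_def[symmetric])
    qed
    show "\<Psi> ` carrier (graph_aut W adj') \<subseteq> carrier (graph_aut V adj)"
      using \<Psi>_in by blast
    show "(\<lambda>g. \<lambda>y\<in>W. \<psi> (g (\<phi> y))) ` carrier (graph_aut V adj) \<subseteq> carrier (graph_aut W adj')"
    proof (rule image_subsetI)
      fix g assume g: "g \<in> carrier (graph_aut V adj)"
      have "(\<lambda>y\<in>W. inv_into W \<phi> (g (\<phi> y))) \<in> carrier (graph_aut W adj')"
        using \<phi> adj' g by (rule graph_aut_conj)
      moreover have "(\<lambda>y\<in>W. inv_into W \<phi> (g (\<phi> y))) = (\<lambda>y\<in>W. \<psi> (g (\<phi> y)))"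
        using \<psi>_eq carrierV[OF g] \<psi>\<phi> by (intro restrict_ext) auto
      ultimately show "(\<lambda>y\<in>W. \<psi> (g (\<phi> y))) \<in> carrier (graph_aut W adj')"
        by simp
    qed
  qed
  moreover have "\<Psi> (f \<otimes>\<^bsub>graph_aut W adj'\<^esub> g) = \<Psi> f \<otimes>\<^bsub>graph_aut V adj\<^esub> \<Psi> g"
    if f: "f \<in> carrier (graph_aut W adj')" and g: "g \<in> carrier (graph_aut W adj')" for f g
    unfolding graph_aut_mult[OF f g] graph_aut_mult[OF \<Psi>_in[OF f] \<Psi>_in[OF g]]
    using carrierW[OF g] \<phi>\<psi> \<psi>\<phi>
    by (intro extensionalityI[of _ V]) (auto simp: \<Psi>_def \<phi>_def[symmetric] compose_eq)
  ultimately have "\<Psi> \<in> iso (graph_aut W adj') (graph_aut V adj)"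
    using \<Psi>_in by (auto simp: iso_def hom_def)
  then show ?thesis
    by (auto simp: is_iso_def)
qed

theorem cube_aut_iso_torus_aut: "cube_aut (2 * m) \<cong> torus_aut m"
  unfolding cube_aut_def torus_aut_def
proof (rule graph_aut_iso)
  show "bij_betw (torus_code m) (positions m) (cube_vertices (2 * m))"
    by (rule torus_code_bij)
qed (rule torus_code_adj)

section \<open>The Weyl group\<close>

global_interpretation signed_vec: signed_permutation_rep n "carrier_vec n" UNIV
  "\<lambda>v i. v $ i" "vec n" "uminus :: real \<Rightarrow> real" for n
  defines vec_act = signed_vec.act
proof (unfold_locales, goal_cases)
  case 7
  then show ?case
    by (intro bexI[of _ 1]) auto
qed auto

text \<open>Elements of C_2^n named by their support, so that they can be assembled by induction on
  a finite set.\<close>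

definition signs :: "nat \<Rightarrow> nat set \<Rightarrow> nat \<Rightarrow> int" where
  "signs n A = (\<lambda>i\<in>{1..n}. if i \<in> A then 1 else 0)"

lemma signs_in: "s permutes {1..n} \<Longrightarrow> (signs n A, s) \<in> carrier (C2_power_semidirect_sym n)"
  by (auto simp: carrier_C2_sym_iff signs_def)

lemma signs_surj:
  assumes "(a, s) \<in> carrier (C2_power_semidirect_sym n)"
  shows "a = signs n {i \<in> {1..n}. a i = 1}"
proof
  fix i
  show "a i = signs n {i \<in> {1..n}. a i = 1} i"
    using assms
    by (cases "i \<in> {1..n}") (auto simp: carrier_C2_sym_iff signs_def PiE_def Pi_def extensional_def)
qed

text \<open>For a short root the reflection is v - 2 v_i e_i, because s^2 = 1.\<close>

lemma reflection_sign:
  assumes i: "i < n" and s: "s \<in> {1, -1 :: real}"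
  shows "reflection n (s \<cdot>\<^sub>v unit_vec n i) = vec_act n (signs n {Suc i}, id)"
proof (intro ext)
  fix v :: "real vec"
  show "reflection n (s \<cdot>\<^sub>v unit_vec n i) v = vec_act n (signs n {Suc i}, id) v"
  proof (cases "v \<in> carrier_vec n")
    case v: True
    have a: "v \<bullet> (s \<cdot>\<^sub>v unit_vec n i) = s * v $ i"
      using v i by simp
    have b: "(s \<cdot>\<^sub>v unit_vec n i) \<bullet> (s \<cdot>\<^sub>v unit_vec n i) = 1"
      using i s by auto
    show ?thesis
    proof (rule eq_vecI)
      have "vec_act n (signs n {Suc i}, id) v \<in> carrier_vec n"
        using signs_in[of id n "{Suc i}"] v by (intro signed_vec.act_in) (auto simp: permutes_id)
      then show "dim_vec (reflection n (s \<cdot>\<^sub>v unit_vec n i) v) = dim_vec (vec_act n (signs n {Suc i}, id) v)"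
        using v by (auto simp: reflection_def)
      fix k assume "k < dim_vec (vec_act n (signs n {Suc i}, id) v)"
      then have k: "k < n"
        using \<open>vec_act n (signs n {Suc i}, id) v \<in> carrier_vec n\<close> by auto
      have "reflection n (s \<cdot>\<^sub>v unit_vec n i) v $ k = v $ k - 2 * (s * v $ i) * (s * (if k = i then 1 else 0))"
        using v k i by (simp add: reflection_def a b)
      also have "\<dots> = (if k = i then - v $ k else v $ k)"
        using s by auto
      also have "\<dots> = vec_act n (signs n {Suc i}, id) v $ k"
        using v k by (simp add: signed_vec.coord_act signs_def inv_id)
      finally show "reflection n (s \<cdot>\<^sub>v unit_vec n i) v $ k = vec_act n (signs n {Suc i}, id) v $ k" .
    qed
  qed (simp add: reflection_def signed_vec.act_def)
qed

text \<open>A long root has squared length 2, so the reflection subtracts (s v_i + t v_j) times the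
  root. This replaces v_i by - s t v_j and v_j by - s t v_i: a swap, with both signs changed exactly
  when s = t.\<close>

lemma reflection_transpose:
  assumes i: "i < n" and j: "j < n" and ij: "i \<noteq> j"
    and s: "s \<in> {1, -1 :: real}" and t: "t \<in> {1, -1 :: real}"
  shows "reflection n (s \<cdot>\<^sub>v unit_vec n i + t \<cdot>\<^sub>v unit_vec n j) =
    vec_act n (signs n (if s = t then {Suc i, Suc j} else {}), Transposition.transpose (Suc i) (Suc j))"
    (is "reflection n ?r = vec_act n ?g")
proof (intro ext)
  have p: "Transposition.transpose (Suc i) (Suc j) permutes {1..n}"
    using i j by (intro permutes_swap_id) auto
  fix v :: "real vec"
  show "reflection n ?r v = vec_act n ?g v"
  proof (cases "v \<in> carrier_vec n")
    case v: True
    have a: "v \<bullet> ?r = s * v $ i + t * v $ j"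
      using v i j by (simp add: scalar_prod_add_distrib[of v n])
    have b: "?r \<bullet> ?r = 2"
      using i j ij s t by (auto simp: scalar_prod_add_distrib[of _ n] add_scalar_prod_distrib[of _ n])
    show ?thesis
    proof (rule eq_vecI)
      have g: "vec_act n ?g v \<in> carrier_vec n"
        using signs_in[OF p] v by (intro signed_vec.act_in)
      then show "dim_vec (reflection n ?r v) = dim_vec (vec_act n ?g v)"
        using v by (auto simp: reflection_def)
      fix k assume "k < dim_vec (vec_act n ?g v)"
      then have k: "k < n"
        using g by auto
      have "reflection n ?r v $ k =
          v $ k - (s * v $ i + t * v $ j) * (s * (if k = i then 1 else 0) + t * (if k = j then 1 else 0))"
        using v k i j by (simp add: reflection_def a b)
      also have "\<dots> = (if k = i then - s * t * v $ j else if k = j then - s * t * v $ i else v $ k)"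
        using s t ij by auto
      also have "\<dots> = vec_act n ?g v $ k"
        using v k s t ij i j
        by (auto simp: signed_vec.coord_act signs_def transpose_def inv_transpose_eq)
      finally show "reflection n ?r v $ k = vec_act n ?g v $ k" .
    qed
  qed (simp add: reflection_def signed_vec.act_def)
qed

lemma mult_signs:
  assumes "i \<notin> A"
  shows "(signs n {i}, id) \<otimes>\<^bsub>C2_power_semidirect_sym n\<^esub> (signs n A, s) = (signs n (insert i A), s)"
  using assms by (auto simp: mult_C2_sym signs_def inv_id intro!: restrict_ext)

lemma mult_perms:
  assumes "s permutes {1..n}"
  shows "(signs n A, s) \<otimes>\<^bsub>C2_power_semidirect_sym n\<^esub> (signs n {}, t) = (signs n A, s \<circ> t)"
  using permutes_inv_into_mem[OF assms] by (auto simp: mult_C2_sym signs_def intro!: restrict_ext)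

text \<open>Every reflection in a root is a signed permutation, which bounds the Weyl group from
  above. Conversely short roots give the single sign changes and the roots e_i - e_j the
  transpositions, and these generate all signed permutations.\<close>

lemma vec_act_image:
  "vec_act n ` carrier (C2_power_semidirect_sym n) = carrier (weyl_B n)"
proof -
  interpret S: group "C2_power_semidirect_sym n"
    by (rule C2_sym_group)
  interpret H: group_hom "C2_power_semidirect_sym n" "BijGroup (carrier_vec n)" "vec_act n"
    by (rule signed_vec.group_hom_act)
  \<comment> \<open>\<open>subgroup_generated\<close> intersects its generators with the carrier;
    that a reflection is a bijection of the space follows from its form as a
    \<open>vec_act\<close>.\<close>
  let ?R = "carrier (BijGroup (carrier_vec n)) \<inter> reflection n ` roots_B n"
  let ?W = "generate (BijGroup (carrier_vec n)) ?R"
  have W: "carrier (weyl_B n) = ?W"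
    by (simp add: weyl_B_def carrier_subgroup_generated)
  have sub: "subgroup ?W (BijGroup (carrier_vec n))"
    by (rule H.H.generate_is_subgroup) simp
  have tr: "Transposition.transpose a b permutes {1..n}" if "a \<in> {1..n}" "b \<in> {1..n}" for a b
    using that by (intro permutes_swap_id)
  have gen: "f \<in> ?W" if "f = reflection n r" "r \<in> roots_B n" "f = vec_act n g"
    "g \<in> carrier (C2_power_semidirect_sym n)" for f r g
    using that H.hom_closed[of g] by (intro generate.incl) auto
  have mult: "vec_act n (g \<otimes>\<^bsub>C2_power_semidirect_sym n\<^esub> h) \<in> ?W"
    if "vec_act n g \<in> ?W" "vec_act n h \<in> ?W" "g \<in> carrier (C2_power_semidirect_sym n)"
      "h \<in> carrier (C2_power_semidirect_sym n)" for g h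
    using that subgroup.m_closed[OF sub] by simp
  have one: "vec_act n (signs n {}, id) \<in> ?W"
  proof -
    have "(signs n {}, id) = \<one>\<^bsub>C2_power_semidirect_sym n\<^esub>"
      by (simp add: one_C2_sym signs_def)
    then show ?thesis
      using subgroup.one_closed[OF sub] H.hom_one by simp
  qed
  have signs: "vec_act n (signs n A, id) \<in> ?W" if "A \<subseteq> {1..n}" for A
  proof -
    have "finite A"
      using that finite_subset by blast
    then show ?thesis
      using that
    proof (induction A rule: finite_induct)
      case (insert i A)
      then have i: "i - 1 < n" "Suc (i - 1) = i"
        by auto
      have "1 \<cdot>\<^sub>v unit_vec n (i - 1) \<in> roots_B n"
        unfolding roots_B_def using i(1) by blast
      then have "vec_act n (signs n {i}, id) \<in> ?W"
        using reflection_sign[of "i - 1" n 1] i signs_in[of id n "{i}"]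
        by (intro gen[OF _ _ refl]) (auto simp: permutes_id)
      moreover have "vec_act n (signs n A, id) \<in> ?W"
        using insert by (simp add: id_def)
      ultimately have "vec_act n ((signs n {i}, id) \<otimes>\<^bsub>C2_power_semidirect_sym n\<^esub> (signs n A, id)) \<in> ?W"
        by (intro mult signs_in permutes_id)
      then have "vec_act n (signs n (insert i A), id) \<in> ?W"
        unfolding mult_signs[OF \<open>i \<notin> A\<close>] .
      then show ?case
        by (simp add: id_def)
    qed (rule one)
  qed
  have perms: "vec_act n (signs n {}, s) \<in> ?W" if "s permutes {1..n}" for s
    using that finite_atLeastAtMost
  proof (induction s rule: permutes_induct)
    case id
    show ?case
      using one by (simp add: id_def)
  next
    case (swap a b p)
    have "vec_act n (signs n {}, Transposition.transpose a b) \<in> ?W"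
    proof (cases "a = b")
      case True
      then show ?thesis
        using one by (simp add: id_def)
    next
      case False
      have ab: "a - 1 < n" "Suc (a - 1) = a" "b - 1 < n" "Suc (b - 1) = b" "a - 1 \<noteq> b - 1"
        using swap False by auto
      \<comment> \<open>Opposite signs are chosen so that the reflection is the bare
        transposition.\<close>
      have r: "1 \<cdot>\<^sub>v unit_vec n (a - 1) + (-1) \<cdot>\<^sub>v unit_vec n (b - 1) \<in> roots_B n"
        unfolding roots_B_def using ab by blast
      show ?thesis
        by (rule gen[OF _ r refl])
          (use reflection_transpose[OF ab(1) ab(3) ab(5), of 1 "-1"] ab tr swap signs_in in auto)
    qed
    then have "vec_act n ((signs n {}, Transposition.transpose a b)
        \<otimes>\<^bsub>C2_power_semidirect_sym n\<^esub> (signs n {}, p)) \<in> ?W"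
      using swap by (intro mult signs_in tr)
    then show ?case
      using swap by (simp only: mult_perms[OF tr])
  qed
  have "vec_act n ` carrier (C2_power_semidirect_sym n) \<subseteq> ?W"
  proof (rule image_subsetI)
    fix g assume g: "g \<in> carrier (C2_power_semidirect_sym n)"
    obtain a s where e: "g = (a, s)"
      by (cases g)
    define A where "A = {i \<in> {1..n}. a i = 1}"
    have A: "A \<subseteq> {1..n}"
      by (auto simp: A_def)
    have a: "a = signs n A"
      using signs_surj[of a s n] g e by (simp add: A_def)
    have s: "s permutes {1..n}"
      using g e by (simp add: carrier_C2_sym_iff)
    have "vec_act n ((signs n A, id) \<otimes>\<^bsub>C2_power_semidirect_sym n\<^esub> (signs n {}, s)) \<in> ?W"
      using A s by (intro mult signs perms signs_in permutes_id)
    then show "vec_act n g \<in> ?W"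
      unfolding mult_perms[OF permutes_id] using a e by simp
  qed
  moreover have "?W \<subseteq> vec_act n ` carrier (C2_power_semidirect_sym n)"
  proof (rule H.H.generate_subgroup_incl[OF _ H.img_is_subgroup])
    have "reflection n r \<in> vec_act n ` carrier (C2_power_semidirect_sym n)" if r: "r \<in> roots_B n" for r
    proof -
      consider s i where "r = s \<cdot>\<^sub>v unit_vec n i" "s \<in> {1, -1}" "i < n"
        | s t i j where "r = s \<cdot>\<^sub>v unit_vec n i + t \<cdot>\<^sub>v unit_vec n j" "s \<in> {1, -1}" "t \<in> {1, -1}"
          "i < n" "j < n" "i \<noteq> j"
        using r unfolding roots_B_def Un_iff mem_Collect_eq by metis
      then show ?thesis
      proof cases
        case 1
        then show ?thesis
          using reflection_sign[of i n s] signs_in[of id n] by (simp add: permutes_id)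
      next
        case 2
        then show ?thesis
          using reflection_transpose[of i n j s t] tr[of "Suc i" "Suc j"]
          by (auto intro!: imageI signs_in)
      qed
    qed
    then show "?R \<subseteq> vec_act n ` carrier (C2_power_semidirect_sym n)"
      by blast
  qed
  ultimately show ?thesis
    using W by blast
qed

theorem C2_sym_iso_weyl_B: "C2_power_semidirect_sym n \<cong> weyl_B n"
  using signed_vec.act_iso[OF vec_act_image[of n]] by (simp add: weyl_B_def subgroup_generated_def)

section \<open>Most-perfect conditions on the hypercube graph\<close>

definition cube_perfect :: "nat \<Rightarrow> ((nat \<Rightarrow> nat) \<Rightarrow> nat) \<Rightarrow> bool" where
  "cube_perfect n h \<longleftrightarrow>
     (\<exists>M. (\<forall>x\<in>cube_vertices n. \<forall>i<n. \<forall>j<n. i \<noteq> j \<longrightarrow>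
             h x + h (flip i x) + h (flip j x) + h (flip i (flip j x)) = M) \<and>
          (\<forall>x\<in>cube_vertices n. 2 * (h x + h (cube_antipode n x)) = M))"

text \<open>The half-way form: its passage to \<open>cube_perfect\<close> is mere substitution along
  \<open>torus_code\<close>, while its comparison with lines, squares and pandiagonals is arithmetic
  modulo 4.\<close>

definition torus_perfect :: "nat \<Rightarrow> ((nat \<Rightarrow> 4) \<Rightarrow> nat) \<Rightarrow> bool" where
  "torus_perfect m h \<longleftrightarrow>
     (\<exists>M. (\<forall>p\<in>positions m. \<forall>k<2 * m. \<forall>l<2 * m. k \<noteq> l \<longrightarrow>
             h p + h (torus_flip k p) + h (torus_flip l p) + h (torus_flip k (torus_flip l p)) = M) \<and>
          (\<forall>p\<in>positions m. 2 * (h p + h (torus_antipode m p)) = M))"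

text \<open>A line is the face spanned by the two directions that code one and the same
  coordinate.\<close>

lemma sum_orthogonal_line:
  fixes h :: "(nat \<Rightarrow> 4) \<Rightarrow> nat"
  shows "(\<Sum>q\<in>orthogonal_line i p. h q) =
    h p + h (torus_flip (2 * i) p) + h (torus_flip (2 * i + 1) p) +
    h (torus_flip (2 * i) (torus_flip (2 * i + 1) p))"
proof -
  have "orthogonal_line i p = (\<lambda>t. p(i := t)) ` UNIV"
    by (auto simp: orthogonal_line_def)
  moreover have "inj (\<lambda>t. p(i := t))"
    by (auto intro!: injI dest: fun_upd_eqD)
  ultimately have "(\<Sum>q\<in>orthogonal_line i p. h q) = (\<Sum>t\<in>UNIV. h (p(i := t)))"
    by (simp add: sum.reindex)
  also have "\<dots> = h (p(i := p i)) + h (p(i := 1 - p i)) + h (p(i := - 1 - p i)) + h (p(i := p i + 2))"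
    by (rule sum_mod4)
  finally show ?thesis
    by (simp add: torus_flip_def algebra_simps)
qed

lemma sum_subsquare:
  fixes h :: "(nat \<Rightarrow> 4) \<Rightarrow> nat"
  assumes "i \<noteq> j"
  shows "(\<Sum>q\<in>subsquare i j a b p. h q) =
    h (p(i := a, j := b)) + h (p(i := a + 1, j := b)) + h (p(i := a, j := b + 1)) +
    h (p(i := a + 1, j := b + 1))"
proof -
  have "subsquare i j a b p = (\<lambda>(x, y). p(i := x, j := y)) ` ({a, a + 1} \<times> {b, b + 1})"
    unfolding subsquare_def by force
  moreover have "inj_on (\<lambda>(x, y). p(i := x, j := y)) ({a, a + 1} \<times> {b, b + 1})"
    using assms by (auto simp: inj_on_def fun_eq_iff split: if_splits)
  moreover have "a \<noteq> a + 1" "b \<noteq> b + 1"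
    by simp_all
  ultimately show ?thesis
    by (simp add: sum.reindex sum.cartesian_product[symmetric])
qed

text \<open>The interval \<open>{a, a + 1}\<close> is an orbit of one of the two flips, depending on the parity
  of \<open>a\<close>.\<close>

lemma torus_flip_edge:
  obtains k where "k div 2 = i" "\<And>p. p i = a \<Longrightarrow> torus_flip k p = p(i := a + 1)"
proof -
  consider "a = 0 \<or> a = 2" | "a = 1 \<or> a = 3"
    using exhaust_mod4[of a] by blast
  then show thesis
  proof cases
    case 1
    then show thesis
      by (intro that[of "2 * i"]) (auto simp: torus_flip_def)
  next
    case 2
    then show thesis
      by (intro that[of "2 * i + 1"]) (auto simp: torus_flip_def)
  qed
qed

text \<open>The counterpart of \<open>torus_flip_edge\<close>: a flip moves its coordinate one step
  up or down, depending on the parity of the value.\<close>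

lemma torus_flip_interval:
  "\<exists>a. (p (k div 2) = a \<and> torus_flip k p (k div 2) = a + 1) \<or>
    (p (k div 2) = a + 1 \<and> torus_flip k p (k div 2) = a)"
proof -
  have "\<exists>a. (t = a \<and> s = a + 1) \<or> (t = a + 1 \<and> s = a)" if "cycle4_adj t s" for s t :: 4
    using that unfolding cycle4_adj_def by auto
  then show ?thesis
    unfolding torus_flip_def cycle4_adj_iff by simp
qed

lemma directions_cases: "d \<in> directions m \<Longrightarrow> i < m \<Longrightarrow> d i = 1 \<or> d i = - 1"
  unfolding directions_def by (drule PiE_mem[of _ _ _ i]) auto

lemma sum_great_pandiagonal:
  fixes h :: "(nat \<Rightarrow> 4) \<Rightarrow> nat"
  assumes "m \<ge> 1" "d \<in> directions m"
  shows "(\<Sum>q\<in>great_pandiagonal m p d. h q) =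
    h (translate m p 0 d) + h (translate m p 1 d) + h (translate m p 2 d) + h (translate m p 3 d)"
proof -
  have "great_pandiagonal m p d = (\<lambda>t. translate m p t d) ` UNIV"
    by (auto simp: great_pandiagonal_def)
  moreover have "inj (\<lambda>t. translate m p t d)"
  proof (rule injI)
    fix s t assume "translate m p s d = translate m p t d"
    \<comment> \<open>As m \<ge> 1 there is a coordinate 0, and d is invertible there; thus the four
      translates are distinct and the sum over the set has four terms.\<close>
    then have "translate m p s d 0 = translate m p t d 0"
      by simp
    then have "s * d 0 = t * d 0"
      using assms(1) by (simp add: translate_def)
    moreover have "d 0 = 1 \<or> d 0 = - 1"
      using directions_cases[OF assms(2)] assms(1) by simp
    ultimately show "s = t"
      by auto
  qed
  ultimately have "(\<Sum>q\<in>great_pandiagonal m p d. h q) = (\<Sum>t\<in>UNIV. h (translate m p t d))"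
    by (simp add: sum.reindex)
  then show ?thesis
    unfolding UNIV_mod4 by simp
qed

text \<open>Modulo 4, 2 and - 2 agree, so two steps lead to the antipode in whatever direction they
  are taken.\<close>

lemma translate_antipode:
  assumes "d \<in> directions m"
  shows "translate m p (t + 2) d = torus_antipode m (translate m p t d)"
proof
  fix i
  have "2 * d i = 2" if "i < m"
    using directions_cases[OF assms that] by (elim disjE) simp_all
  then show "translate m p (t + 2) d i = torus_antipode m (translate m p t d) i"
    by (simp add: translate_def torus_antipode_def distrib_right)
qed

lemma translate_in: "translate m p t d \<in> positions m"
  by (simp add: translate_def positions_def)

lemma translate_zero: "p \<in> positions m \<Longrightarrow> translate m p 0 d = p"
  by (auto simp: translate_def positions_def PiE_def extensional_def)

text \<open>Two directions coding the same coordinate span an orthogonal line, two directions of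
  different coordinates a subsquare.\<close>

lemma most_perfect_imp_torus_perfect:
  assumes "most_perfect m h"
  shows "torus_perfect m h"
proof -
  obtain M where
    line: "\<And>p i. p \<in> positions m \<Longrightarrow> i < m \<Longrightarrow> (\<Sum>q\<in>orthogonal_line i p. h q) = M" and
    square: "\<And>p i j a b. p \<in> positions m \<Longrightarrow> i < m \<Longrightarrow> j < m \<Longrightarrow> i \<noteq> j \<Longrightarrow>
      (\<Sum>q\<in>subsquare i j a b p. h q) = M" and
    pair: "\<And>p d t. p \<in> positions m \<Longrightarrow> d \<in> directions m \<Longrightarrow>
      2 * (h (translate m p t d) + h (translate m p (t + 2) d)) = M"
    using assms unfolding most_perfect_def by metis
  have "h p + h (torus_flip k p) + h (torus_flip l p) + h (torus_flip k (torus_flip l p)) = M"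
    if p: "p \<in> positions m" and k: "k < 2 * m" and l: "l < 2 * m" and "k \<noteq> l" for p k l
  proof (cases "k div 2 = l div 2")
    case True
    define i where "i = k div 2"
    have i: "i < m"
      using k by (simp add: i_def)
    have c: "torus_flip (2 * i + 1) (torus_flip (2 * i) p) =
        torus_flip (2 * i) (torus_flip (2 * i + 1) p)"
      using exhaust_mod4[of "p i"] by (elim disjE) (simp_all add: torus_flip_def fun_eq_iff)
    have "k = 2 * i + k mod 2"
      unfolding i_def by (simp only: mult_div_mod_eq)
    moreover have "l = 2 * i + l mod 2"
      unfolding i_def True by (simp only: mult_div_mod_eq)
    moreover have "k mod 2 = 0 \<or> k mod 2 = 1" "l mod 2 = 0 \<or> l mod 2 = 1"
      by auto
    ultimately have "(k = 2 * i \<and> l = 2 * i + 1) \<or> (k = 2 * i + 1 \<and> l = 2 * i)"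
      using \<open>k \<noteq> l\<close> by linarith
    then have "h p + h (torus_flip k p) + h (torus_flip l p) + h (torus_flip k (torus_flip l p)) =
        (\<Sum>q\<in>orthogonal_line i p. h q)"
      unfolding sum_orthogonal_line using c by (elim disjE conjE) simp_all
    then show ?thesis
      using line[OF p i] by simp
  next
    case False
    let ?i = "k div 2" and ?j = "l div 2"
    have ij: "?i < m" "?j < m"
      using k l by auto
    obtain a where a: "(p ?i = a \<and> torus_flip k p ?i = a + 1) \<or>
        (p ?i = a + 1 \<and> torus_flip k p ?i = a)"
      using torus_flip_interval by blast
    obtain b where b: "(p ?j = b \<and> torus_flip l p ?j = b + 1) \<or>
        (p ?j = b + 1 \<and> torus_flip l p ?j = b)"
      using torus_flip_interval by blast
    \<comment> \<open>The face and the subsquare have the same four points, but which corner p is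
      depends on parities; the terms are therefore indexed by the two coordinate values and
      rearranged.\<close>
    define P where "P x y = h (p(?i := x, ?j := y))" for x y
    have "h p = P (p ?i) (p ?j)"
      by (simp add: P_def)
    moreover have "h (torus_flip k p) = P (torus_flip k p ?i) (p ?j)"
      unfolding P_def torus_flip_def using False by (intro arg_cong[of _ _ h]) auto
    moreover have "h (torus_flip l p) = P (p ?i) (torus_flip l p ?j)"
      unfolding P_def torus_flip_def using False by (intro arg_cong[of _ _ h]) auto
    moreover have "h (torus_flip k (torus_flip l p)) = P (torus_flip k p ?i) (torus_flip l p ?j)"
      unfolding P_def torus_flip_def using False by (intro arg_cong[of _ _ h]) (auto simp: fun_eq_iff)
    moreover have "P a b + P (a + 1) b + P a (b + 1) + P (a + 1) (b + 1) = M"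
      using square[OF p ij False, of a b] unfolding sum_subsquare[OF False] P_def .
    ultimately show ?thesis
      using a b by (elim disjE conjE) (simp_all add: ac_simps)
  qed
  moreover have "2 * (h p + h (torus_antipode m p)) = M" if p: "p \<in> positions m" for p
  proof -
    have d: "(\<lambda>i\<in>{..<m}. 1) \<in> directions m"
      by (simp add: directions_def)
    show ?thesis
      using pair[OF p d, of 0] translate_antipode[OF d, of p 0] translate_zero[OF p] by simp
  qed
  ultimately show ?thesis
    unfolding torus_perfect_def by blast
qed

text \<open>Every line and every subsquare is a face, and points two apart on a pandiagonal are
  antipodes.\<close>

lemma torus_perfect_imp_most_perfect:
  assumes "m \<ge> 1" and "torus_perfect m h"
  shows "most_perfect m h"
proof -
  obtain M where
    face: "\<And>p k l. p \<in> positions m \<Longrightarrow> k < 2 * m \<Longrightarrow> l < 2 * m \<Longrightarrow> k \<noteq> l \<Longrightarrow>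
      h p + h (torus_flip k p) + h (torus_flip l p) + h (torus_flip k (torus_flip l p)) = M" and
    anti: "\<And>p. p \<in> positions m \<Longrightarrow> 2 * (h p + h (torus_antipode m p)) = M"
    using assms(2) unfolding torus_perfect_def by metis
  have "(\<Sum>q\<in>orthogonal_line i p. h q) = M" if "p \<in> positions m" "i < m" for p i
    unfolding sum_orthogonal_line using that by (intro face) auto
  moreover have "(\<Sum>q\<in>subsquare i j a b p. h q) = M"
    if p: "p \<in> positions m" and i: "i < m" and j: "j < m" and ij: "i \<noteq> j" for p i j a b
  proof -
    obtain k where k: "k div 2 = i" "\<And>p. p i = a \<Longrightarrow> torus_flip k p = p(i := a + 1)"
      by (metis torus_flip_edge)
    obtain l where l: "l div 2 = j" "\<And>p. p j = b \<Longrightarrow> torus_flip l p = p(j := b + 1)"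
      by (metis torus_flip_edge)
    let ?q = "p(i := a, j := b)"
    have q: "?q \<in> positions m"
      using p i j by (intro positions_upd)
    have "k < 2 * m" "l < 2 * m" "k \<noteq> l"
      using k(1) l(1) i j ij by auto
    then have "h ?q + h (torus_flip k ?q) + h (torus_flip l ?q) + h (torus_flip k (torus_flip l ?q)) = M"
      by (rule face[OF q])
    moreover have "torus_flip k ?q = p(i := a + 1, j := b)"
      using ij by (subst k(2)) (auto simp: fun_eq_iff)
    moreover have "torus_flip l ?q = p(i := a, j := b + 1)"
      using ij by (subst l(2)) (auto simp: fun_eq_iff)
    moreover have "torus_flip k (p(i := a, j := b + 1)) = p(i := a + 1, j := b + 1)"
      using ij by (subst k(2)) (auto simp: fun_eq_iff)
    ultimately show ?thesis
      unfolding sum_subsquare[OF ij] by simp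
  qed
  moreover have pair: "2 * (h (translate m p t d) + h (translate m p (t + 2) d)) = M"
    if "p \<in> positions m" "d \<in> directions m" for p d t
    unfolding translate_antipode[OF that(2)] using translate_in by (rule anti)
  \<comment> \<open>A pandiagonal splits into two antipodal pairs, t = 0, 2 and t = 1, 3, each
    contributing half of M.\<close>
  moreover have "(\<Sum>q\<in>great_pandiagonal m p d. h q) = M"
    if "p \<in> positions m" "d \<in> directions m" for p d
    using pair[OF that, of 0] pair[OF that, of 1]
    unfolding sum_great_pandiagonal[OF assms(1) that(2)] by simp
  ultimately show ?thesis
    unfolding most_perfect_def by (intro exI[of _ M] conjI ballI allI impI) blast+
qed

lemma torus_perfect_cube_perfect:
  assumes "\<And>p. p \<in> positions m \<Longrightarrow> h p = H (torus_code m p)"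
  shows "torus_perfect m h \<longleftrightarrow> cube_perfect (2 * m) H"
proof -
  have V: "cube_vertices (2 * m) = torus_code m ` positions m"
    using torus_code_bij by (simp add: bij_betw_def)
  have face: "h p + h (torus_flip k p) + h (torus_flip l p) + h (torus_flip k (torus_flip l p)) =
      H (torus_code m p) + H (flip k (torus_code m p)) + H (flip l (torus_code m p)) +
      H (flip k (flip l (torus_code m p)))"
    if "p \<in> positions m" "k < 2 * m" "l < 2 * m" for p k l
    using that by (simp add: assms torus_flip_in torus_code_flip)
  have anti: "h p + h (torus_antipode m p) =
      H (torus_code m p) + H (cube_antipode (2 * m) (torus_code m p))" if "p \<in> positions m" for p
    using that by (simp add: assms torus_antipode_in torus_code_antipode)
  show ?thesis
    unfolding torus_perfect_def cube_perfect_def V ball_simps(9)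
    using face anti by (intro ex_cong1 conj_cong ball_cong refl) (metis (no_types, lifting))+
qed

section \<open>Most-perfect arrangements are signed binary expansions\<close>

definition vertex_sign :: "nat \<Rightarrow> (nat \<Rightarrow> nat) \<Rightarrow> int" where
  "vertex_sign n x = (\<Prod>i<n. (- 1) ^ x i)"

lemma sign_cases: "(- 1) ^ k = (1 :: int) \<or> (- 1) ^ k = (- 1 :: int)"
  by (cases "even k") auto

lemma prod_sign_cases:
  fixes y :: "nat \<Rightarrow> int"
  assumes "\<And>i. i < n \<Longrightarrow> y i = 1 \<or> y i = - 1"
  shows "(\<Prod>i<n. y i) = 1 \<or> (\<Prod>i<n. y i) = - 1"
  using assms
proof (induction n)
  case (Suc n)
  have "y n = 1 \<or> y n = - 1" "(\<Prod>i<n. y i) = 1 \<or> (\<Prod>i<n. y i) = - 1"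
    using Suc by simp_all
  then show ?case
    by auto
qed simp

lemma vertex_sign_cases: "vertex_sign n x = 1 \<or> vertex_sign n x = - 1"
  unfolding vertex_sign_def by (rule prod_sign_cases) (rule sign_cases)

lemma sign_flip:
  assumes "x \<in> cube_vertices n" "k < n"
  shows "(- 1) ^ flip k x i = (if i = k then - ((- 1) ^ x i) else (- 1) ^ x i :: int)"
  using cube_vertex_cases[OF assms] by (auto simp: flip_apply)

lemma vertex_sign_flip:
  assumes "x \<in> cube_vertices n" "k < n"
  shows "vertex_sign n (flip k x) = - vertex_sign n x"
proof -
  have "vertex_sign n y = (- 1) ^ y k * (\<Prod>i\<in>{..<n} - {k}. (- 1) ^ y i)" for y
    unfolding vertex_sign_def using assms(2) by (subst prod.remove[of _ k]) auto
  moreover have "(\<Prod>i\<in>{..<n} - {k}. (- 1) ^ flip k x i) = (\<Prod>i\<in>{..<n} - {k}. (- 1) ^ x i :: int)"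
    using sign_flip[OF assms] by (intro prod.cong) auto
  ultimately show ?thesis
    using sign_flip[OF assms, of k] by simp
qed

lemma weighted_sum_flip:
  fixes b :: "nat \<Rightarrow> int"
  assumes "x \<in> cube_vertices n" "k < n"
  shows "(\<Sum>i<n. (- 1) ^ flip k x i * b i) = (\<Sum>i<n. (- 1) ^ x i * b i) - 2 * (- 1) ^ x k * b k"
proof -
  have "(\<Sum>i<n. (- 1) ^ y i * b i) = (- 1) ^ y k * b k + (\<Sum>i\<in>{..<n} - {k}. (- 1) ^ y i * b i)" for y
    using assms(2) by (subst sum.remove[of _ k]) auto
  moreover have "(\<Sum>i\<in>{..<n} - {k}. (- 1) ^ flip k x i * b i) = (\<Sum>i\<in>{..<n} - {k}. (- 1) ^ x i * b i)"
    using sign_flip[OF assms] by (intro sum.cong) auto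
  ultimately show ?thesis
    using sign_flip[OF assms, of k] by simp
qed

lemma cube_antipode_in: "cube_antipode n x \<in> cube_vertices n"
proof -
  have "1 - x i \<in> {0, 1}" for i
    by (cases "x i") auto
  then show ?thesis
    unfolding cube_antipode_def cube_vertices_def by (intro restrict_PiE_iff[THEN iffD2] ballI)
qed

lemma cube_antipode_antipode:
  assumes "x \<in> cube_vertices n"
  shows "cube_antipode n (cube_antipode n x) = x"
proof (rule cube_vertices_eqI[OF _ assms])
  fix i assume "i < n"
  then show "cube_antipode n (cube_antipode n x) i = x i"
    using cube_vertex_cases[OF assms \<open>i < n\<close>] by (auto simp: cube_antipode_def)
qed (rule cube_antipode_in)

lemma sign_antipode:
  assumes "x \<in> cube_vertices n" "i < n"
  shows "(- 1) ^ cube_antipode n x i = (- ((- 1) ^ x i) :: int)"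
  using cube_vertex_cases[OF assms] assms(2) by (auto simp: cube_antipode_def)

text \<open>Complementing all n bits multiplies the sign by (-1)^n.\<close>

lemma vertex_sign_antipode:
  assumes "x \<in> cube_vertices n" "even n"
  shows "vertex_sign n (cube_antipode n x) = vertex_sign n x"
proof -
  have "vertex_sign n (cube_antipode n x) = (\<Prod>i<n. - 1 * (- 1) ^ x i)"
    unfolding vertex_sign_def using sign_antipode[OF assms(1)] by (intro prod.cong) auto
  also have "\<dots> = (- 1) ^ n * vertex_sign n x"
    unfolding prod.distrib vertex_sign_def by simp
  finally show ?thesis
    using assms(2) by simp
qed

lemma weighted_sum_antipode:
  fixes b :: "nat \<Rightarrow> int"
  assumes "x \<in> cube_vertices n"
  shows "(\<Sum>i<n. (- 1) ^ cube_antipode n x i * b i) = - (\<Sum>i<n. (- 1) ^ x i * b i)"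
  unfolding sum_negf[symmetric] using sign_antipode[OF assms] by (intro sum.cong) auto

lemma card_cube_vertices: "card (cube_vertices n) = 2 ^ n"
  by (simp add: cube_vertices_def card_PiE numeral_2_eq_2[symmetric])

lemma finite_cube_vertices: "finite (cube_vertices n)"
  by (auto simp: cube_vertices_def intro!: finite_PiE)

text \<open>Since \<open>n\<close> is even, the product over all coordinates of the sign vector
  \<open>vertex_sign n x * (- 1) ^ x i\<close> recovers \<open>vertex_sign n x\<close>.\<close>

lemma obtain_signed_vertex:
  fixes y :: "nat \<Rightarrow> int"
  assumes n: "even n" and y: "\<And>i. i < n \<Longrightarrow> y i = 1 \<or> y i = - 1"
  obtains x where "x \<in> cube_vertices n" "\<And>i. i < n \<Longrightarrow> vertex_sign n x * (- 1) ^ x i = y i"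
proof -
  define Y where "Y = (\<Prod>i<n. y i)"
  have Y: "Y = 1 \<or> Y = - 1"
    unfolding Y_def using y by (rule prod_sign_cases)
  define x where "x = (\<lambda>i\<in>{..<n}. if Y * y i = 1 then 0 else 1 :: nat)"
  have x: "x \<in> cube_vertices n"
    by (auto simp: x_def cube_vertices_def)
  have xi: "(- 1) ^ x i = Y * y i" if "i < n" for i
    using that y[OF that] Y by (auto simp: x_def)
  have "vertex_sign n x = (\<Prod>i<n. Y * y i)"
    unfolding vertex_sign_def using xi by (intro prod.cong) auto
  also have "\<dots> = Y ^ n * Y"
    by (simp add: prod.distrib Y_def)
  also have "\<dots> = Y"
    using Y n by auto
  finally have "vertex_sign n x * (- 1) ^ x i = y i" if "i < n" for i
    using xi[OF that] Y by auto
  then show thesis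
    using x that by blast
qed

text \<open>Connectedness of Q_n as an induction rule; it serves to show that quantities unchanged
  by flips are constant.\<close>

lemma cube_induct [consumes 1, case_names zero flip]:
  assumes "x \<in> cube_vertices n" and zero: "P (cube_zero n)"
    and flip: "\<And>x k. x \<in> cube_vertices n \<Longrightarrow> k < n \<Longrightarrow> P x \<Longrightarrow> P (flip k x)"
  shows "P x"
  using assms(1)
proof (induction "card {i. i < n \<and> x i = 1}" arbitrary: x rule: less_induct)
  case less
  note x = \<open>x \<in> cube_vertices n\<close>
  show ?case
  proof (cases "\<exists>k<n. x k = 1")
    case True
    then obtain k where k: "k < n" "x k = 1"
      by blast
    have "{i. i < n \<and> flip k x i = 1} \<subseteq> {i. i < n \<and> x i = 1} - {k}"
      using k by (auto simp: flip_apply)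
    then have "card {i. i < n \<and> flip k x i = 1} < card {i. i < n \<and> x i = 1}"
      using k by (intro psubset_card_mono) auto
    then have "P (flip k x)"
      using less.hyps flip_in[OF x k(1)] by blast
    then have "P (flip k (flip k x))"
      using flip flip_in[OF x k(1)] k(1) by blast
    then show ?thesis
      using flip_flip[OF x k(1)] by simp
  next
    case False
    then have "x = cube_zero n"
      using cube_vertex_cases[OF x]
      by (intro cube_vertices_eqI[OF x cube_zero_in]) (auto simp: cube_zero_def)
    then show ?thesis
      using zero by simp
  qed
qed

text \<open>The constant is found by summing the antipodal condition over all vertices: 2^n M is
  four times the sum of the entries, that is 2 * 2^n * (2^n + 1).\<close>

lemma cube_perfectD:
  assumes h: "cube_perfect n h" "bij_betw h (cube_vertices n) {1..2 ^ n}"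
  shows "x \<in> cube_vertices n \<Longrightarrow> i < n \<Longrightarrow> j < n \<Longrightarrow> i \<noteq> j \<Longrightarrow>
      h x + h (flip i x) + h (flip j x) + h (flip i (flip j x)) = 2 * (2 ^ n + 1)"
    and "x \<in> cube_vertices n \<Longrightarrow> h x + h (cube_antipode n x) = 2 ^ n + 1"
proof -
  obtain M where face: "\<And>x i j. x \<in> cube_vertices n \<Longrightarrow> i < n \<Longrightarrow> j < n \<Longrightarrow> i \<noteq> j \<Longrightarrow>
      h x + h (flip i x) + h (flip j x) + h (flip i (flip j x)) = M"
    and anti: "\<And>x. x \<in> cube_vertices n \<Longrightarrow> 2 * (h x + h (cube_antipode n x)) = M"
    using h(1) unfolding cube_perfect_def by metis
  let ?V = "cube_vertices n"
  have "bij_betw (cube_antipode n) ?V ?V"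
    by (rule bij_betw_byWitness[of _ "cube_antipode n"]) (auto simp: cube_antipode_antipode cube_antipode_in)
  then have "(\<Sum>x\<in>?V. h (cube_antipode n x)) = (\<Sum>x\<in>?V. h x)"
    by (rule sum.reindex_bij_betw)
  moreover have "(\<Sum>x\<in>?V. 2 * (h x + h (cube_antipode n x))) = 2 ^ n * M"
    using anti by (simp add: card_cube_vertices)
  moreover have "(\<Sum>x\<in>?V. h x) = \<Sum>{1..2 ^ n}"
    using sum.reindex_bij_betw[OF h(2), of "\<lambda>x. x"] by simp
  moreover have "2 * \<Sum>{1..2 ^ n} = 2 ^ n * (2 ^ n + 1 :: nat)"
    using double_gauss_sum_from_Suc_0[of "2 ^ n", where ?'a = nat] by simp
  ultimately have "2 ^ n * M = 2 ^ n * (2 * (2 ^ n + 1))"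
    by (simp add: sum_distrib_left[symmetric] sum.distrib)
  then have M: "M = 2 * (2 ^ n + 1)"
    by (metis mult_left_cancel power_not_zero zero_neq_numeral)
  show "x \<in> cube_vertices n \<Longrightarrow> i < n \<Longrightarrow> j < n \<Longrightarrow> i \<noteq> j \<Longrightarrow>
      h x + h (flip i x) + h (flip j x) + h (flip i (flip j x)) = 2 * (2 ^ n + 1)"
    using face unfolding M .
  show "x \<in> cube_vertices n \<Longrightarrow> h x + h (cube_antipode n x) = 2 ^ n + 1"
    using anti[of x] unfolding M by simp
qed

text \<open>The face condition says that \<open>vertex_sign n x * (2 * h x - (2 ^ n + 1))\<close> has vanishing
  mixed second differences, so it is affine in the coordinates; the antipodal condition removes the
  constant term.\<close>

lemma cube_perfect_affine:
  assumes n: "even n" and h: "cube_perfect n h" "bij_betw h (cube_vertices n) {1..2 ^ n}"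
  obtains b :: "nat \<Rightarrow> int" where
    "\<And>x. x \<in> cube_vertices n \<Longrightarrow>
      2 * int (h x) - (2 ^ n + 1) = vertex_sign n x * (\<Sum>i<n. (- 1) ^ x i * b i)"
proof -
  define F where "F x = 2 * int (h x) - (2 ^ n + 1)" for x
  have face: "F x + F (flip i x) + F (flip j x) + F (flip i (flip j x)) = 0"
    if "x \<in> cube_vertices n" "i < n" "j < n" "i \<noteq> j" for x i j
    using cube_perfectD(1)[OF h that, THEN arg_cong[where f = int]] by (simp add: F_def)
  have anti: "F (cube_antipode n x) = - F x" if "x \<in> cube_vertices n" for x
    using cube_perfectD(2)[OF h that, THEN arg_cong[where f = int]] by (simp add: F_def)
  \<comment> \<open>The difference of \<chi> * F along the edge in direction i, always taken from
    the end with bit 0 to the end with bit 1: the factor (-1)^(x i) fixes the orientation.\<close>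
  define g where "g i x = vertex_sign n x * (- 1) ^ x i * (F x + F (flip i x))" for i x
  \<comment> \<open>Half of g i at the zero vertex, an integer because 2 h enters F.\<close>
  define b where "b i = int (h (cube_zero n)) + int (h (flip i (cube_zero n))) - (2 ^ n + 1)" for i
  have g: "g i x = 2 * b i" if "x \<in> cube_vertices n" "i < n" for x i
    using that(1)
  proof (induction rule: cube_induct)
    case zero
    have "cube_zero n j = 0" if "j < n" for j
      using that by (simp add: cube_zero_def)
    then show ?case
      using that(2) by (simp add: g_def b_def F_def vertex_sign_def)
  next
    case (flip x k)
    have "g i (flip k x) = g i x"
    proof (cases "k = i")
      case True
      then show ?thesis
        using flip_flip[OF flip(1,2)] sign_flip[OF flip(1,2), of i] vertex_sign_flip[OF flip(1,2)]
        by (simp add: g_def)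
    next
      case False
      then have F: "F (flip k x) + F (flip i (flip k x)) = - (F x + F (flip i x))"
        using face[OF flip(1) that(2) flip(2)] by simp
      have s: "(- 1) ^ flip k x i = ((- 1) ^ x i :: int)"
        using False sign_flip[OF flip(1,2), of i] by simp
      show ?thesis
        unfolding g_def F s vertex_sign_flip[OF flip(1,2)] by (simp only: mult_minus_left minus_mult_minus)
    qed
    then show ?case
      using flip by simp
  qed
  define G where "G x = vertex_sign n x * F x - (\<Sum>i<n. (- 1) ^ x i * b i)" for x
  have G: "G x = G (cube_zero n)" if "x \<in> cube_vertices n" for x
    using that
  proof (induction rule: cube_induct)
    case (flip x k)
    have "vertex_sign n x * (F x + F (flip k x)) = 2 * (- 1) ^ x k * b k"
      using g[OF flip(1,2)] sign_cases[of "x k"] by (auto simp: g_def)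
    then have "G (flip k x) = G x"
      unfolding G_def weighted_sum_flip[OF flip(1,2)] vertex_sign_flip[OF flip(1,2)]
      by (simp add: algebra_simps)
    then show ?case
      using flip by simp
  qed simp
  have "G (cube_antipode n x) = - G x" if "x \<in> cube_vertices n" for x
    unfolding G_def weighted_sum_antipode[OF that] vertex_sign_antipode[OF that n] anti[OF that] by simp
  then have "G (cube_antipode n (cube_zero n)) = - G (cube_zero n)"
    using cube_zero_in by blast
  moreover have "G (cube_antipode n (cube_zero n)) = G (cube_zero n)"
    using cube_antipode_in by (rule G)
  ultimately have G0: "G (cube_zero n) = 0"
    by linarith
  have "F x = vertex_sign n x * (\<Sum>i<n. (- 1) ^ x i * b i)" if "x \<in> cube_vertices n" for x
  proof -
    have "vertex_sign n x * F x = (\<Sum>i<n. (- 1) ^ x i * b i)"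
      using G[OF that] G0 by (simp add: G_def)
    then show ?thesis
      using vertex_sign_cases[of n x] by (elim disjE) simp_all
  qed
  then show thesis
    unfolding F_def by (rule that)
qed

section \<open>Weights whose subset sums fill an interval\<close>

lemma set_decode_subset:
  assumes "v < 2 ^ k"
  shows "set_decode v \<subseteq> {..<k}"
proof
  fix j assume j: "j \<in> set_decode v"
  have "2 ^ j = (\<Sum>i\<in>{j}. 2 ^ i :: nat)"
    by simp
  also have "\<dots> \<le> set_encode (set_decode v)"
    unfolding set_encode_def using j by (intro sum_mono2) auto
  also have "\<dots> < 2 ^ k"
    using assms by simp
  finally show "j \<in> {..<k}"
    by simp
qed

lemma inj_on_power_index:
  fixes a c :: "nat \<Rightarrow> nat"
  assumes "\<And>j. j < k \<Longrightarrow> c j < n \<and> a (c j) = 2 ^ j"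
  shows "inj_on c {..<k}"
proof (rule inj_onI)
  fix i j assume ij: "i \<in> {..<k}" "j \<in> {..<k}" and eq: "c i = c j"
  have "2 ^ i = a (c i)"
    using assms[of i] ij(1) by simp
  also have "\<dots> = a (c j)"
    by (rule arg_cong[OF eq])
  also have "\<dots> = 2 ^ j"
    using assms[of j] ij(2) by simp
  finally show "i = j"
    by simp
qed

text \<open>By induction on \<open>k\<close>: once the powers below \<open>2 ^ k\<close> occur, their subset sums exhaust
  the numbers below \<open>2 ^ k\<close>, so a further weight is at least \<open>2 ^ k\<close>.\<close>

lemma subset_sums_imp_powers:
  fixes a :: "nat \<Rightarrow> nat"
  assumes inj: "inj_on (\<lambda>S. \<Sum>i\<in>S. a i) (Pow {..<n})"
    and surj: "{..<2 ^ n} \<subseteq> (\<lambda>S. \<Sum>i\<in>S. a i) ` Pow {..<n}"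
    and "k < n"
  shows "\<exists>i<n. a i = 2 ^ k"
  using \<open>k < n\<close>
proof (induction k rule: less_induct)
  case (less k)
  then have "\<exists>i. i < n \<and> a i = 2 ^ j" if "j < k" for j
    using that by simp
  then obtain c where c: "\<And>j. j < k \<Longrightarrow> c j < n \<and> a (c j) = 2 ^ j"
    by metis
  have "inj_on c {..<k}"
    using c by (rule inj_on_power_index)
  then have sum_c: "(\<Sum>i\<in>c ` J. a i) = (\<Sum>j\<in>J. 2 ^ j)" if "J \<subseteq> {..<k}" for J
    using that c by (subst sum.reindex) (auto intro: inj_on_subset intro!: sum.cong)
  have cover: "\<exists>S\<subseteq>c ` {..<k}. (\<Sum>i\<in>S. a i) = v" if "v < 2 ^ k" for v
    using set_decode_subset[OF that] sum_c[of "set_decode v"] set_decode_inverse[of v]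
    by (intro exI[of _ "c ` set_decode v"]) (auto simp: set_encode_def)
  have "(2 :: nat) ^ k \<in> {..<2 ^ n}"
    using less.prems by simp
  \<comment> \<open>The smaller powers add up to 2^k - 1 only, so a set of weights with sum 2^k
    contains another index, whose weight is at most 2^k.\<close>
  then obtain S where S: "S \<subseteq> {..<n}" "(\<Sum>i\<in>S. a i) = 2 ^ k"
    using surj by (smt (verit) PowD imageE subsetD)
  have "\<not> S \<subseteq> c ` {..<k}"
  proof
    assume "S \<subseteq> c ` {..<k}"
    then have "(\<Sum>i\<in>S. a i) \<le> (\<Sum>i\<in>c ` {..<k}. a i)"
      by (intro sum_mono2) auto
    also have "\<dots> = (\<Sum>j<k. 2 ^ j)"
      by (rule sum_c) simp
    also have "\<dots> < 2 ^ k"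
      by (induction k) auto
    finally show False
      using S by simp
  qed
  then obtain i where i: "i \<in> S" "i \<notin> c ` {..<k}"
    by blast
  have "finite S"
    using S finite_subset by blast
  then have "a i \<le> 2 ^ k"
    using S(2) i(1) by (metis member_le_sum zero_le)
  \<comment> \<open>A smaller weight would equal a sum of the powers already found, giving two
    different sets with the same sum.\<close>
  moreover have "\<not> a i < 2 ^ k"
  proof
    assume "a i < 2 ^ k"
    then obtain T where T: "T \<subseteq> c ` {..<k}" "(\<Sum>i\<in>T. a i) = a i"
      using cover by blast
    have "c ` {..<k} \<subseteq> {..<n}"
      using c by blast
    then have "T \<in> Pow {..<n}" "{i} \<in> Pow {..<n}"
      using T(1) S(1) i(1) by blast+
    then have "T = {i}"
      using inj_onD[OF inj, of T "{i}"] T(2) by simp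
    then show False
      using T(1) i(2) by blast
  qed
  ultimately show ?case
    using S(1) i(1) by (intro exI[of _ i]) auto
qed

text \<open>There are just 2^n subsets, so reaching 2^n values makes the subset sums injective, as
  \<open>subset_sums_imp_powers\<close> requires.\<close>

lemma subset_sums_imp_permuted_powers:
  fixes a :: "nat \<Rightarrow> nat"
  assumes surj: "{..<2 ^ n} \<subseteq> (\<lambda>S. \<Sum>i\<in>S. a i) ` Pow {..<n}"
  obtains p where "p permutes {..<n}" "\<And>i. i < n \<Longrightarrow> a i = 2 ^ p i"
proof -
  let ?f = "\<lambda>S. \<Sum>i\<in>S. a i"
  have "card (?f ` Pow {..<n}) \<ge> 2 ^ n"
    using card_mono[OF _ surj] by simp
  moreover have "card (?f ` Pow {..<n}) \<le> 2 ^ n"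
    using card_image_le[of "Pow {..<n}" ?f] by (simp add: card_Pow)
  ultimately have inj: "inj_on ?f (Pow {..<n})"
    by (intro eq_card_imp_inj_on) (auto simp: card_Pow)
  obtain c where c: "\<And>k. k < n \<Longrightarrow> c k < n \<and> a (c k) = 2 ^ k"
    using subset_sums_imp_powers[OF inj surj] by metis
  have ci: "inj_on c {..<n}"
    using c by (rule inj_on_power_index)
  moreover have "c ` {..<n} \<subseteq> {..<n}"
    using c by auto
  ultimately have cb: "bij_betw c {..<n} {..<n}"
    by (simp add: bij_betw_def endo_inj_surj)
  define p where "p i = (if i < n then inv_into {..<n} c i else i)" for i
  have "bij_betw p {..<n} {..<n}"
    using bij_betw_inv_into[OF cb] by (rule bij_betw_cong[THEN iffD1, rotated]) (simp add: p_def)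
  then have "p permutes {..<n}"
    by (rule bij_imp_permutes) (simp add: p_def)
  moreover have "a i = 2 ^ p i" if "i < n" for i
  proof -
    have "i \<in> c ` {..<n}"
      using that cb by (simp add: bij_betw_def)
    then have "c (p i) = i" "p i \<in> {..<n}"
      unfolding p_def using that inv_into_into[of i c "{..<n}"] by (simp_all add: f_inv_into_f)
    then show ?thesis
      using c[of "p i"] by simp
  qed
  ultimately show thesis
    by (rule that)
qed

text \<open>The total s of the absolute weights must be 2^n - 1: aligning all signs with those of b
  gives the value s, bounded by the entry 2^n, and the entry 2^n itself needs at least this total.
  Signed sums then become subset sums through y = 2 * [y agrees with b] - 1.\<close>

lemma cube_perfect_weights:
  fixes b :: "nat \<Rightarrow> int"
  assumes n: "even n" and h: "bij_betw h (cube_vertices n) {1..2 ^ n}"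
    and b: "\<And>x. x \<in> cube_vertices n \<Longrightarrow>
      2 * int (h x) - (2 ^ n + 1) = vertex_sign n x * (\<Sum>i<n. (- 1) ^ x i * b i)"
  obtains p where "p permutes {..<n}" "\<And>i. i < n \<Longrightarrow> \<bar>b i\<bar> = 2 ^ p i"
proof -
  define e where "e i = (if b i < 0 then - 1 else 1 :: int)" for i
  define y where "y x i = vertex_sign n x * (- 1) ^ x i" for x i
  have hb: "2 * int (h x) - (2 ^ n + 1) = (\<Sum>i<n. y x i * b i)" if "x \<in> cube_vertices n" for x
    using b[OF that] by (simp add: y_def sum_distrib_left mult.assoc)
  have ycases: "y x i = 1 \<or> y x i = - 1" for x i
    using vertex_sign_cases[of n x] sign_cases[of "x i"] by (auto simp: y_def)
  have hx: "\<exists>x\<in>cube_vertices n. h x = v" if "v \<in> {1..2 ^ n}" for v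
  proof -
    have "v \<in> h ` cube_vertices n"
      unfolding bij_betw_imp_surj_on[OF h] by (rule that)
    then show ?thesis
      by blast
  qed
  have hle: "int (h x) \<le> 2 ^ n" if "x \<in> cube_vertices n" for x
  proof -
    have "h x \<in> {1..2 ^ n}"
      using h that by (rule bij_betwE[THEN bspec])
    then have "int (h x) \<le> int (2 ^ n)"
      by (subst of_nat_le_iff) simp
    then show ?thesis
      by simp
  qed
  define s where "s = (\<Sum>i<n. \<bar>b i\<bar>)"
  obtain x0 where x0: "x0 \<in> cube_vertices n" "\<And>i. i < n \<Longrightarrow> y x0 i = e i"
    unfolding y_def by (rule obtain_signed_vertex[OF n, of e]) (auto simp: e_def)
  have "(\<Sum>i<n. y x0 i * b i) = s"
    unfolding s_def using x0(2) by (intro sum.cong) (auto simp: e_def)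
  then have s_le: "s \<le> 2 ^ n - 1"
    using hb[OF x0(1)] hle[OF x0(1)] by linarith
  obtain x1 where x1: "x1 \<in> cube_vertices n" "h x1 = 2 ^ n"
    using hx[of "2 ^ n"] by auto
  have "(\<Sum>i<n. y x1 i * b i) \<le> s"
    unfolding s_def
  proof (rule sum_mono)
    fix i show "y x1 i * b i \<le> \<bar>b i\<bar>"
      using ycases[of x1 i] by auto
  qed
  moreover have "int (h x1) = 2 ^ n"
    using x1(2) by simp
  ultimately have s: "s = 2 ^ n - 1"
    using hb[OF x1(1)] s_le by linarith
  have "v \<in> (\<lambda>S. \<Sum>i\<in>S. nat \<bar>b i\<bar>) ` Pow {..<n}" if v: "v < 2 ^ n" for v
  proof -
    obtain x where x: "x \<in> cube_vertices n" "h x = v + 1"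
      using hx[of "v + 1"] v by auto
    \<comment> \<open>Where the sign agrees with that of b. The entry v + 1 has centred value 2 v -
      s, so these weights sum to v.\<close>
    let ?S = "{i \<in> {..<n}. y x i = e i}"
    have "y x i * b i = 2 * (if y x i = e i then \<bar>b i\<bar> else 0) - \<bar>b i\<bar>" for i
      using ycases[of x i] by (auto simp: e_def)
    then have "(\<Sum>i<n. y x i * b i) = 2 * (\<Sum>i<n. if y x i = e i then \<bar>b i\<bar> else 0) - s"
      by (simp add: s_def sum_subtractf sum_distrib_left)
    also have "(\<Sum>i<n. if y x i = e i then \<bar>b i\<bar> else 0) = (\<Sum>i\<in>?S. \<bar>b i\<bar>)"
      by (rule sum.inter_filter[symmetric]) simp
    finally have "(\<Sum>i\<in>?S. \<bar>b i\<bar>) = int v"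
      using hb[OF x(1)] x(2) s by linarith
    then have "int (\<Sum>i\<in>?S. nat \<bar>b i\<bar>) = int v"
      by simp
    then have "(\<Sum>i\<in>?S. nat \<bar>b i\<bar>) = v"
      by (simp only: of_nat_eq_iff)
    then show ?thesis
      by (intro image_eqI[of _ _ ?S]) auto
  qed
  then obtain p where p: "p permutes {..<n}" "\<And>i. i < n \<Longrightarrow> nat \<bar>b i\<bar> = 2 ^ p i"
    using subset_sums_imp_permuted_powers[of n "\<lambda>i. nat \<bar>b i\<bar>"] by (metis lessThan_iff subsetI)
  have "\<bar>b i\<bar> = 2 ^ p i" if "i < n" for i
    using arg_cong[OF p(2)[OF that], of int] by simp
  with p(1) show thesis
    by (rule that)
qed

section \<open>The action on most-perfect hypercubes\<close>

text \<open>The standard centred arrangement, with weights 2^i in natural order and positive. All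
  others turn out to be pullbacks of it along signed permutations.\<close>

definition weight_sum :: "nat \<Rightarrow> (nat \<Rightarrow> nat) \<Rightarrow> int" where
  "weight_sum n x = vertex_sign n x * (\<Sum>i<n. (- 1) ^ x i * 2 ^ i)"

lemma cube_perfect_weight_sum:
  assumes n: "even n" and h: "cube_perfect n h" "bij_betw h (cube_vertices n) {1..2 ^ n}"
  obtains g where "g \<in> carrier (C2_power_semidirect_sym n)"
    "\<And>x. x \<in> cube_vertices n \<Longrightarrow> 2 * int (h x) - (2 ^ n + 1) = weight_sum n (cube_act n g x)"
proof -
  obtain b where b: "\<And>x. x \<in> cube_vertices n \<Longrightarrow>
      2 * int (h x) - (2 ^ n + 1) = vertex_sign n x * (\<Sum>i<n. (- 1) ^ x i * b i)"
    using cube_perfect_affine[OF n h] by blast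
  obtain p where p: "p permutes {..<n}" "\<And>i. i < n \<Longrightarrow> \<bar>b i\<bar> = 2 ^ p i"
    using cube_perfect_weights[OF n h(2) b] by blast
  define q where "q = inv_into UNIV p"
  have pq: "p (q k) = k" "q (p k) = k" for k
    using permutes_inverses[OF p(1)] by (simp_all add: q_def)
  have p_lt: "p k < n" if "k < n" for k
    using permutes_in_image[OF p(1), of k] that by simp
  have q_lt: "q k < n" if "k < n" for k
    using permutes_inv_into_mem[OF p(1), of k] that by (simp add: q_def)
  have q_bij: "bij_betw q {..<n} {..<n}"
    unfolding q_def by (rule permutes_imp_bij[OF permutes_inv[OF p(1)]])
  have p_bij: "bij_betw p {..<n} {..<n}"
    by (rule permutes_imp_bij[OF p(1)])
  define e where "e i = (if b i < 0 then - 1 else 1 :: int)" for i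
  have e: "e i = 1 \<or> e i = - 1" for i
    by (simp add: e_def)
  have be: "b i = e i * 2 ^ p i" if "i < n" for i
    unfolding p(2)[OF that, symmetric] by (simp add: e_def)
  \<comment> \<open>Using the signs e alone would multiply the parity sign by E. With E * e instead,
    the parity sign is multiplied by E^n * E = E, the weighted sum by E as well, and the two factors
    cancel.\<close>
  define E where "E = (\<Prod>i<n. e i)"
  have E: "E = 1 \<or> E = - 1"
    unfolding E_def using e by (rule prod_sign_cases)
  define s where "s i = (if i \<in> {1..n} then Suc (p (i - 1)) else i)" for i
  define a where "a = (\<lambda>i\<in>{1..n}. if E * e (q (i - 1)) = 1 then 0 else 1 :: int)"
  have "p ` {..<n} \<subseteq> {..<n}" "inj_on p {..<n}"
    using p_bij by (auto simp: bij_betw_def)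
  then have s: "s permutes {1..n}"
    unfolding s_def[abs_def] by (intro permutes_shift)
  have sq: "inv_into UNIV s (Suc k) = Suc (q k)" if "k < n" for k
    using q_lt[OF that] pq(1)[of k] permutes_inv_eq[OF s, of "Suc k" "Suc (q k)"] by (simp add: s_def)
  have g: "(a, s) \<in> carrier (C2_power_semidirect_sym n)"
    using s by (auto simp: carrier_C2_sym_iff a_def)
  have "2 * int (h x) - (2 ^ n + 1) = weight_sum n (cube_act n (a, s) x)"
    if x: "x \<in> cube_vertices n" for x
  proof -
    let ?y = "cube_act n (a, s) x"
    have y: "(- 1) ^ ?y k = E * e (q k) * (- 1) ^ x (q k)" if k: "k < n" for k
    proof -
      have "?y k = (if a (Suc k) = 0 then id else (\<lambda>k. 1 - k)) (x (q k))"
        using x k sq[OF k] by (simp add: cube.coord_act)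
      moreover have "E * e (q k) = 1 \<or> E * e (q k) = - 1"
        using E e[of "q k"] by auto
      ultimately show ?thesis
        using cube_vertex_cases[OF x q_lt[OF k]] k by (auto simp: a_def)
    qed
    have "vertex_sign n ?y = (\<Prod>k<n. E * (e (q k) * (- 1) ^ x (q k)))"
      unfolding vertex_sign_def using y by (intro prod.cong) (auto simp: mult.assoc)
    also have "\<dots> = E ^ n * (\<Prod>k<n. e (q k) * (- 1) ^ x (q k))"
      by (simp add: prod.distrib)
    also have "(\<Prod>k<n. e (q k) * (- 1) ^ x (q k)) = (\<Prod>i<n. e i * (- 1) ^ x i)"
      by (rule prod.reindex_bij_betw[OF q_bij])
    also have "\<dots> = E * vertex_sign n x"
      by (simp add: prod.distrib E_def vertex_sign_def)
    also have "E ^ n = 1"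
      using E n by auto
    finally have sign: "vertex_sign n ?y = E * vertex_sign n x"
      by simp
    have "(\<Sum>k<n. (- 1) ^ ?y k * 2 ^ k) = (\<Sum>k<n. E * (e (q k) * (- 1) ^ x (q k) * 2 ^ p (q k)))"
      using y by (intro sum.cong) (auto simp: pq)
    also have "\<dots> = E * (\<Sum>k<n. e (q k) * (- 1) ^ x (q k) * 2 ^ p (q k))"
      by (rule sum_distrib_left[symmetric])
    also have "(\<Sum>k<n. e (q k) * (- 1) ^ x (q k) * 2 ^ p (q k)) = (\<Sum>i<n. e i * (- 1) ^ x i * 2 ^ p i)"
      by (rule sum.reindex_bij_betw[OF q_bij])
    also have "\<dots> = (\<Sum>i<n. (- 1) ^ x i * b i)"
      using be by (intro sum.cong) auto
    finally have "weight_sum n ?y = E * E * (vertex_sign n x * (\<Sum>i<n. (- 1) ^ x i * b i))"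
      unfolding weight_sum_def sign by (simp only: mult_ac)
    moreover have "E * E = 1"
      using E by auto
    ultimately show ?thesis
      using b[OF x] by simp
  qed
  with g show thesis
    by (rule that)
qed

section \<open>Existence: binary digits give a most-perfect arrangement of the cube\<close>

lemma weight_sum_face:
  assumes x: "x \<in> cube_vertices n" and i: "i < n" and j: "j < n" and "i \<noteq> j"
  shows "weight_sum n x + weight_sum n (flip i x) + weight_sum n (flip j x) +
    weight_sum n (flip i (flip j x)) = 0"
proof -
  have "flip j x i = x i"
    using \<open>i \<noteq> j\<close> by (simp add: flip_apply)
  then show ?thesis
    unfolding weight_sum_def weighted_sum_flip[OF x i] weighted_sum_flip[OF x j]
      weighted_sum_flip[OF flip_in[OF x j] i]
      vertex_sign_flip[OF x i] vertex_sign_flip[OF x j] vertex_sign_flip[OF flip_in[OF x j] i]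
    by (simp add: algebra_simps)
qed

lemma weight_sum_antipode:
  assumes "x \<in> cube_vertices n" "even n"
  shows "weight_sum n (cube_antipode n x) = - weight_sum n x"
  unfolding weight_sum_def weighted_sum_antipode[OF assms(1)] vertex_sign_antipode[OF assms] by simp

text \<open>The sign vector of x read as binary digits, with + 1 as digit 1, and shifted by one so
  that the entries start at 1.\<close>

definition base_cube :: "nat \<Rightarrow> (nat \<Rightarrow> nat) \<Rightarrow> nat" where
  "base_cube n x = Suc (set_encode {i. i < n \<and> vertex_sign n x * (- 1) ^ x i = 1})"

text \<open>A sign y corresponds to the digit (y + 1) / 2, and the weights add up to 2^n -
  1.\<close>

lemma base_cube_weight_sum: "2 * int (base_cube n x) - (2 ^ n + 1) = weight_sum n x"
proof -
  define y where "y i = vertex_sign n x * (- 1) ^ x i" for i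
  let ?S = "{i \<in> {..<n}. y i = 1}"
  have y: "y i = 1 \<or> y i = - 1" for i
    using vertex_sign_cases[of n x] sign_cases[of "x i"] by (auto simp: y_def)
  have yi: "y i * 2 ^ i = 2 * (if y i = 1 then 2 ^ i else 0) - 2 ^ i" for i
    using y[of i] by auto
  have "weight_sum n x = (\<Sum>i<n. y i * 2 ^ i)"
    by (simp add: weight_sum_def y_def sum_distrib_left mult.assoc)
  also have "\<dots> = (\<Sum>i<n. 2 * (if y i = 1 then 2 ^ i else 0) - 2 ^ i)"
    using yi by simp
  also have "\<dots> = 2 * (\<Sum>i<n. if y i = 1 then 2 ^ i else 0) - (\<Sum>i<n. 2 ^ i)"
    by (simp add: sum_subtractf sum_distrib_left)
  also have "(\<Sum>i<n. if y i = 1 then 2 ^ i else 0) = (\<Sum>i\<in>?S. 2 ^ i :: int)"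
    by (rule sum.inter_filter[symmetric]) simp
  also have "\<dots> = int (set_encode {i. i < n \<and> y i = 1})"
    by (simp add: set_encode_def)
  also have "(\<Sum>i<n. 2 ^ i) = (2 ^ n - 1 :: int)"
    by (induction n) auto
  finally show ?thesis
    by (simp add: base_cube_def y_def)
qed

lemma base_cube_bij:
  assumes "even n"
  shows "bij_betw (base_cube n) (cube_vertices n) {1..2 ^ n}"
proof -
  have sub: "{1..2 ^ n} \<subseteq> base_cube n ` cube_vertices n"
  proof
    fix v :: nat assume v: "v \<in> {1..2 ^ n}"
    then have d: "set_decode (v - 1) \<subseteq> {..<n}"
      by (intro set_decode_subset) auto
    obtain x where x: "x \<in> cube_vertices n"
      "\<And>i. i < n \<Longrightarrow> vertex_sign n x * (- 1) ^ x i = (if i \<in> set_decode (v - 1) then 1 else - 1)"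
      by (rule obtain_signed_vertex[OF assms, of "\<lambda>i. if i \<in> set_decode (v - 1) then 1 else - 1"]) auto
    have "{i. i < n \<and> vertex_sign n x * (- 1) ^ x i = 1} = set_decode (v - 1)"
      using x(2) d by (auto split: if_splits)
    then have "base_cube n x = v"
      using v by (simp add: base_cube_def)
    then show "v \<in> base_cube n ` cube_vertices n"
      using x(1) by blast
  qed
  have "card (base_cube n ` cube_vertices n) \<le> card {1..2 ^ n :: nat}"
    using card_image_le[OF finite_cube_vertices, of "base_cube n" n] by (simp add: card_cube_vertices)
  then have eq: "{1..2 ^ n} = base_cube n ` cube_vertices n"
    by (intro card_seteq sub finite_imageI finite_cube_vertices)
  then have "card (base_cube n ` cube_vertices n) = card (cube_vertices n)"
    by (simp add: card_cube_vertices flip: eq)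
  then have "inj_on (base_cube n) (cube_vertices n)"
    by (intro eq_card_imp_inj_on finite_cube_vertices)
  then show ?thesis
    using eq by (simp add: bij_betw_def)
qed

lemma base_cube_perfect:
  assumes "even n"
  shows "cube_perfect n (base_cube n)"
proof -
  have b: "2 * int (base_cube n x) = weight_sum n x + (2 ^ n + 1)" for x
    using base_cube_weight_sum[of n x] by simp
  have "base_cube n x + base_cube n (flip i x) + base_cube n (flip j x) +
      base_cube n (flip i (flip j x)) = 2 * (2 ^ n + 1)"
    if "x \<in> cube_vertices n" "i < n" "j < n" "i \<noteq> j" for x i j
  proof -
    have "2 * int (base_cube n x + base_cube n (flip i x) + base_cube n (flip j x) +
        base_cube n (flip i (flip j x))) = 2 * int (2 * (2 ^ n + 1))"
      using weight_sum_face[OF that] by (simp add: distrib_left b)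
    then show ?thesis
      by (simp only: mult_cancel_left of_nat_eq_iff) simp
  qed
  moreover have "2 * (base_cube n x + base_cube n (cube_antipode n x)) = 2 * (2 ^ n + 1)"
    if "x \<in> cube_vertices n" for x
  proof -
    have "2 * int (base_cube n x + base_cube n (cube_antipode n x)) = 2 * int (2 ^ n + 1)"
      using weight_sum_antipode[OF that assms] by (simp add: distrib_left b)
    then show ?thesis
      by (simp only: mult_cancel_left of_nat_eq_iff) simp
  qed
  ultimately show ?thesis
    unfolding cube_perfect_def by blast
qed

section \<open>Invariance and transitivity on the cube\<close>

lemma cube_aut_obtain:
  assumes "f \<in> carrier (cube_aut n)"
  obtains a s where "(a, s) \<in> carrier (C2_power_semidirect_sym n)" "f = cube_act n (a, s)"
  using assms unfolding cube_act_image[symmetric] by (metis imageE surj_pair)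

text \<open>Complementing all bits commutes with permuting them and with complementing some of
  them.\<close>

lemma cube_act_antipode:
  assumes g: "(a, s) \<in> carrier (C2_power_semidirect_sym n)" and x: "x \<in> cube_vertices n"
  shows "cube_act n (a, s) (cube_antipode n x) = cube_antipode n (cube_act n (a, s) x)"
proof (rule cube_vertices_eqI[OF cube_act_in[OF g cube_antipode_in] cube_antipode_in])
  fix i assume i: "i < n"
  have s: "s permutes {1..n}"
    using g by (simp add: carrier_C2_sym_iff)
  show "cube_act n (a, s) (cube_antipode n x) i = cube_antipode n (cube_act n (a, s) x) i"
    using i cube.inv_Suc(1)[OF s i]
    by (simp add: cube.coord_act[OF cube_antipode_in i] cube.coord_act[OF x i]) (simp add: cube_antipode_def cube.coord_act[OF x i])
qed

lemma cube_perfect_aut: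
  assumes f: "f \<in> carrier (cube_aut n)" and h: "cube_perfect n h"
  shows "cube_perfect n (\<lambda>x. h (f x))"
proof -
  obtain M where face: "\<And>x i j. x \<in> cube_vertices n \<Longrightarrow> i < n \<Longrightarrow> j < n \<Longrightarrow> i \<noteq> j \<Longrightarrow>
      h x + h (flip i x) + h (flip j x) + h (flip i (flip j x)) = M"
    and anti: "\<And>x. x \<in> cube_vertices n \<Longrightarrow> 2 * (h x + h (cube_antipode n x)) = M"
    using h unfolding cube_perfect_def by metis
  obtain a s where g: "(a, s) \<in> carrier (C2_power_semidirect_sym n)" and fg: "f = cube_act n (a, s)"
    using f by (rule cube_aut_obtain)
  let ?t = "\<lambda>k. s (Suc k) - 1"
  have t: "?t k < n" if "k < n" for k
    using cube_act_flip(1)[OF g cube_zero_in that] .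
  have "?t i \<noteq> ?t j" if "i < n" "j < n" "i \<noteq> j" for i j
  proof
    assume "?t i = ?t j"
    then have "f (flip i (cube_zero n)) = f (flip j (cube_zero n))"
      using cube_act_flip(2)[OF g cube_zero_in] that(1,2) by (simp add: fg)
    then have "flip i (cube_zero n) = flip j (cube_zero n)"
      using cube_autD(2)[OF f] flip_in[OF cube_zero_in] that(1,2) by (metis inj_onD)
    then show False
      using flip_inj[OF cube_zero_in that(1,2)] that(3) by blast
  qed
  then have "h (f x) + h (f (flip i x)) + h (f (flip j x)) + h (f (flip i (flip j x))) = M"
    if "x \<in> cube_vertices n" "i < n" "j < n" "i \<noteq> j" for x i j
    using face[OF cube_autD(3)[OF f that(1)] t t, of i j] that cube_act_flip(2)[OF g] flip_in
    by (simp add: fg)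
  moreover have "2 * (h (f x) + h (f (cube_antipode n x))) = M" if "x \<in> cube_vertices n" for x
    using anti[OF cube_autD(3)[OF f that]] cube_act_antipode[OF g that] by (simp add: fg)
  ultimately show ?thesis
    unfolding cube_perfect_def by blast
qed

text \<open>Both arrangements are pullbacks of \<open>weight_sum\<close>, along g and g', so g'^-1 g
  carries one to the other.\<close>

lemma cube_perfect_transitive:
  assumes n: "even n"
    and h: "cube_perfect n h" "bij_betw h (cube_vertices n) {1..2 ^ n}"
    and h': "cube_perfect n h'" "bij_betw h' (cube_vertices n) {1..2 ^ n}"
  obtains f where "f \<in> carrier (cube_aut n)" "\<And>x. x \<in> cube_vertices n \<Longrightarrow> h x = h' (f x)"
proof -
  interpret G: group "C2_power_semidirect_sym n"
    by (rule C2_sym_group)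
  obtain g where g: "g \<in> carrier (C2_power_semidirect_sym n)"
    "\<And>x. x \<in> cube_vertices n \<Longrightarrow> 2 * int (h x) - (2 ^ n + 1) = weight_sum n (cube_act n g x)"
    using cube_perfect_weight_sum[OF n h] by blast
  obtain g' where g': "g' \<in> carrier (C2_power_semidirect_sym n)"
    "\<And>x. x \<in> cube_vertices n \<Longrightarrow> 2 * int (h' x) - (2 ^ n + 1) = weight_sum n (cube_act n g' x)"
    using cube_perfect_weight_sum[OF n h'] by blast
  let ?k = "inv\<^bsub>C2_power_semidirect_sym n\<^esub> g' \<otimes>\<^bsub>C2_power_semidirect_sym n\<^esub> g"
  have k: "?k \<in> carrier (C2_power_semidirect_sym n)"
    using g g' by simp
  show thesis
  proof (rule that[OF cube_act_aut[OF k]])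
    fix x assume x: "x \<in> cube_vertices n"
    have "cube_act n g' (cube_act n ?k x) = cube_act n g x"
      using cube.act_mult[of "inv\<^bsub>C2_power_semidirect_sym n\<^esub> g'" n g x]
        cube.act_inv(2)[OF g'(1) cube_act_in[OF g(1) x]] g(1) g'(1) x by simp
    then have "2 * int (h x) - (2 ^ n + 1) = 2 * int (h' (cube_act n ?k x)) - (2 ^ n + 1)"
      using g(2)[OF x] g'(2)[OF cube_act_in[OF k x]] by simp
    then show "h x = h' (cube_act n ?k x)"
      by simp
  qed
qed

section \<open>Transport between the cube and the grid\<close>

definition transfer :: "nat \<Rightarrow> ((nat \<Rightarrow> 4) \<Rightarrow> nat) \<Rightarrow> (nat \<Rightarrow> nat) \<Rightarrow> nat" where
  "transfer m h x = h (inv_into (positions m) (torus_code m) x)"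

lemma transfer_code: "p \<in> positions m \<Longrightarrow> transfer m h (torus_code m p) = h p"
  using torus_code_bij[of m] by (simp add: transfer_def bij_betw_def)

lemma most_perfect_iff_cube_perfect:
  assumes "m \<ge> 1" and "\<And>p. p \<in> positions m \<Longrightarrow> h p = H (torus_code m p)"
  shows "most_perfect m h \<longleftrightarrow> cube_perfect (2 * m) H"
  using most_perfect_imp_torus_perfect torus_perfect_imp_most_perfect[OF assms(1)]
    torus_perfect_cube_perfect[of m h H, OF assms(2)] by blast

lemma transfer_perfect:
  assumes "m \<ge> 1" and h: "h \<in> most_perfect_hypercubes m"
  shows "cube_perfect (2 * m) (transfer m h)"
    and "bij_betw (transfer m h) (cube_vertices (2 * m)) {1..2 ^ (2 * m)}"
proof -
  have hb: "bij_betw h (positions m) {1..4 ^ m}" and hp: "most_perfect m h"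
    using h by (simp_all add: most_perfect_hypercubes_def)
  show "cube_perfect (2 * m) (transfer m h)"
    using hp most_perfect_iff_cube_perfect[of m h "transfer m h"] assms(1) transfer_code by metis
  have "bij_betw (h \<circ> inv_into (positions m) (torus_code m)) (cube_vertices (2 * m)) {1..4 ^ m}"
    using bij_betw_inv_into[OF torus_code_bij] hb by (rule bij_betw_trans)
  then show "bij_betw (transfer m h) (cube_vertices (2 * m)) {1..2 ^ (2 * m)}"
    by (simp add: comp_def transfer_def[abs_def] power_mult)
qed

lemma torus_autD:
  assumes "g \<in> carrier (torus_aut m)"
  shows "g \<in> Bij (positions m)" "bij_betw g (positions m) (positions m)"
    and "p \<in> positions m \<Longrightarrow> g p \<in> positions m"
proof -
  show *: "g \<in> Bij (positions m)"
    using assms by (simp add: torus_aut_def graph_aut_carrier_iff)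
  show "bij_betw g (positions m) (positions m)"
    using * by (simp add: Bij_def)
  show "p \<in> positions m \<Longrightarrow> g p \<in> positions m"
    using Bij_imp_funcset[OF *] by blast
qed

text \<open>Conjugated by the code, g becomes an automorphism of the cube graph, where invariance is
  known from \<open>cube_perfect_aut\<close>.\<close>

lemma most_perfect_torus_aut:
  assumes m: "m \<ge> 1" and g: "g \<in> carrier (torus_aut m)" and h: "h \<in> most_perfect_hypercubes m"
  shows "(\<lambda>p\<in>positions m. h (g p)) \<in> most_perfect_hypercubes m"
proof -
  let ?i = "inv_into (positions m) (torus_code m)"
  have i: "?i x \<in> positions m" "torus_code m (?i x) = x" if "x \<in> cube_vertices (2 * m)" for x
    using that torus_code_bij[of m] by (auto simp: bij_betw_def inv_into_into f_inv_into_f)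
  have i': "inv_into (cube_vertices (2 * m)) ?i p = torus_code m p" if "p \<in> positions m" for p
    using that torus_code_bij[of m] inv_into_inv_into_eq by metis
  define f where "f = (\<lambda>x\<in>cube_vertices (2 * m). inv_into (cube_vertices (2 * m)) ?i (g (?i x)))"
  have f: "f \<in> carrier (cube_aut (2 * m))"
    unfolding f_def cube_aut_def
  proof (rule graph_aut_conj)
    show "bij_betw ?i (cube_vertices (2 * m)) (positions m)"
      by (rule bij_betw_inv_into[OF torus_code_bij])
    show "g \<in> carrier (graph_aut (positions m) (torus_adj m))"
      using g by (simp add: torus_aut_def)
    fix x y assume "x \<in> cube_vertices (2 * m)" "y \<in> cube_vertices (2 * m)"
    then show "torus_adj m (?i x) (?i y) \<longleftrightarrow> cube_adj (2 * m) x y"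
      using torus_code_adj[of "?i x" m "?i y"] i by simp
  qed
  have fp: "f (torus_code m p) = torus_code m (g p)" if "p \<in> positions m" for p
    using that torus_code_in[of m p] i' torus_autD(3)[OF g that] torus_code_bij[of m]
    by (simp add: f_def bij_betw_def)
  have "cube_perfect (2 * m) (\<lambda>x. transfer m h (f x))"
    by (rule cube_perfect_aut[OF f transfer_perfect(1)[OF m h]])
  moreover have "(\<lambda>p\<in>positions m. h (g p)) p = transfer m h (f (torus_code m p))"
    if "p \<in> positions m" for p
    using that fp[OF that] transfer_code[OF torus_autD(3)[OF g that]] by simp
  then have "most_perfect m (\<lambda>p\<in>positions m. h (g p)) \<longleftrightarrow>
      cube_perfect (2 * m) (\<lambda>x. transfer m h (f x))"
    by (intro most_perfect_iff_cube_perfect m)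
  ultimately have "most_perfect m (\<lambda>p\<in>positions m. h (g p))"
    by simp
  moreover have "bij_betw (h \<circ> g) (positions m) {1..4 ^ m}"
    using torus_autD(2)[OF g] h by (intro bij_betw_trans) (auto simp: most_perfect_hypercubes_def)
  then have "bij_betw (\<lambda>p\<in>positions m. h (g p)) (positions m) {1..4 ^ m}"
    by (rule bij_betw_cong[THEN iffD1, rotated]) simp
  ultimately show ?thesis
    by (simp add: most_perfect_hypercubes_def)
qed

lemma most_perfect_transitive:
  assumes m: "m \<ge> 1" and h: "h \<in> most_perfect_hypercubes m" and h': "h' \<in> most_perfect_hypercubes m"
  obtains g where "g \<in> carrier (torus_aut m)" "h' = (\<lambda>p\<in>positions m. h (g p))"
proof -
  \<comment> \<open>The roles are exchanged: h' is the arrangement to be expressed through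
    h.\<close>
  obtain f where f: "f \<in> carrier (cube_aut (2 * m))"
    "\<And>x. x \<in> cube_vertices (2 * m) \<Longrightarrow> transfer m h' x = transfer m h (f x)"
    using cube_perfect_transitive[of "2 * m" "transfer m h'" "transfer m h"]
      transfer_perfect[OF m h] transfer_perfect[OF m h'] by auto
  define g where "g = (\<lambda>p\<in>positions m. inv_into (positions m) (torus_code m) (f (torus_code m p)))"
  have g: "g \<in> carrier (torus_aut m)"
    unfolding g_def torus_aut_def
  proof (rule graph_aut_conj)
    show "bij_betw (torus_code m) (positions m) (cube_vertices (2 * m))"
      by (rule torus_code_bij)
    show "f \<in> carrier (graph_aut (cube_vertices (2 * m)) (cube_adj (2 * m)))"
      using f(1) by (simp add: cube_aut_def)
  qed (rule torus_code_adj)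
  have "h' = (\<lambda>p\<in>positions m. h (g p))"
  proof (rule extensionalityI)
    show "h' \<in> extensional (positions m)"
      using h' by (simp add: most_perfect_hypercubes_def)
    fix p assume p: "p \<in> positions m"
    have "h' p = transfer m h (f (torus_code m p))"
      using f(2)[OF torus_code_in] transfer_code[OF p, of h'] by simp
    also have "\<dots> = h (g p)"
      using p by (simp add: transfer_def g_def)
    finally show "h' p = (\<lambda>p\<in>positions m. h (g p)) p"
      using p by simp
  qed simp
  with g show thesis
    by (rule that)
qed

lemma most_perfect_nonempty:
  assumes m: "m \<ge> 1"
  shows "most_perfect_hypercubes m \<noteq> {}"
proof -
  define h where "h = (\<lambda>p\<in>positions m. base_cube (2 * m) (torus_code m p))"
  have "most_perfect m h"
    using most_perfect_iff_cube_perfect[OF m, of h "base_cube (2 * m)"] base_cube_perfect[of "2 * m"]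
    by (simp add: h_def)
  moreover have "bij_betw (base_cube (2 * m) \<circ> torus_code m) (positions m) {1..2 ^ (2 * m)}"
    using torus_code_bij base_cube_bij by (rule bij_betw_trans) simp
  then have "bij_betw h (positions m) {1..2 ^ (2 * m)}"
    by (rule bij_betw_cong[THEN iffD1, rotated]) (simp add: h_def)
  then have "bij_betw h (positions m) {1..4 ^ m}"
    by (simp add: power_mult)
  ultimately have "h \<in> most_perfect_hypercubes m"
    by (simp add: most_perfect_hypercubes_def h_def)
  then show ?thesis
    by blast
qed

section \<open>The group action: homomorphism, faithfulness, single orbit\<close>

lemma torus_aut_inverse:
  assumes "g \<in> carrier (torus_aut m)"
  shows "inv\<^bsub>torus_aut m\<^esub> g = (\<lambda>p\<in>positions m. inv_into (positions m) g p)"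
proof -
  interpret T: group "torus_aut m"
    unfolding torus_aut_def by (rule graph_aut_group)
  have "subgroup (carrier (torus_aut m)) (BijGroup (positions m))"
    unfolding torus_aut_def by (rule graph_aut_subgroup)
  then have "inv\<^bsub>torus_aut m\<^esub> g = inv\<^bsub>BijGroup (positions m)\<^esub> g"
    using group.m_inv_consistent[OF group_BijGroup _ assms]
    by (simp add: torus_aut_def graph_aut_def)
  then show ?thesis
    using inv_BijGroup[OF torus_autD(1)[OF assms]] by simp
qed

text \<open>With the group inverse in place of \<open>inv_into\<close>, the laws of the action
  become laws of the group.\<close>

lemma hypercube_action_apply:
  assumes "g \<in> carrier (torus_aut m)" "h \<in> most_perfect_hypercubes m"
  shows "hypercube_action m g h = (\<lambda>p\<in>positions m. h ((inv\<^bsub>torus_aut m\<^esub> g) p))"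
  using assms by (simp add: hypercube_action_def torus_aut_inverse cong: restrict_cong)

lemma hypercube_action_in:
  assumes "m \<ge> 1" "g \<in> carrier (torus_aut m)" "h \<in> most_perfect_hypercubes m"
  shows "hypercube_action m g h \<in> most_perfect_hypercubes m"
proof -
  interpret T: group "torus_aut m"
    unfolding torus_aut_def by (rule graph_aut_group)
  show ?thesis
    unfolding hypercube_action_apply[OF assms(2,3)]
    using assms by (intro most_perfect_torus_aut T.inv_closed)
qed

text \<open>Precomposition reverses products and so does inversion; together they give a left
  action.\<close>

lemma hypercube_action_mult:
  assumes m: "m \<ge> 1" and f: "f \<in> carrier (torus_aut m)" and g: "g \<in> carrier (torus_aut m)"
    and h: "h \<in> most_perfect_hypercubes m"
  shows "hypercube_action m (f \<otimes>\<^bsub>torus_aut m\<^esub> g) h = hypercube_action m f (hypercube_action m g h)"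
proof -
  interpret T: group "torus_aut m"
    unfolding torus_aut_def by (rule graph_aut_group)
  have i: "(inv\<^bsub>torus_aut m\<^esub> (f \<otimes>\<^bsub>torus_aut m\<^esub> g)) p = (inv\<^bsub>torus_aut m\<^esub> g) ((inv\<^bsub>torus_aut m\<^esub> f) p)"
    if "p \<in> positions m" for p
    using that f g graph_aut_mult[of "inv\<^bsub>torus_aut m\<^esub> g" "positions m" "torus_adj m" "inv\<^bsub>torus_aut m\<^esub> f"]
    by (simp add: T.inv_mult_group compose_eq flip: torus_aut_def)
  have f_in: "(inv\<^bsub>torus_aut m\<^esub> f) p \<in> positions m" if "p \<in> positions m" for p
    using torus_autD(3)[OF T.inv_closed[OF f] that] .
  have "hypercube_action m (f \<otimes>\<^bsub>torus_aut m\<^esub> g) h =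
      (\<lambda>p\<in>positions m. h ((inv\<^bsub>torus_aut m\<^esub> g) ((inv\<^bsub>torus_aut m\<^esub> f) p)))"
    unfolding hypercube_action_apply[OF T.m_closed[OF f g] h] using i by (intro restrict_ext) simp
  also have "\<dots> = (\<lambda>p\<in>positions m. hypercube_action m g h ((inv\<^bsub>torus_aut m\<^esub> f) p))"
    unfolding hypercube_action_apply[OF g h] using f_in by (intro restrict_ext) simp
  also have "\<dots> = hypercube_action m f (hypercube_action m g h)"
    by (rule hypercube_action_apply[OF f hypercube_action_in[OF m g h], symmetric])
  finally show ?thesis .
qed

lemma hypercube_action_one:
  assumes "h \<in> most_perfect_hypercubes m"
  shows "hypercube_action m \<one>\<^bsub>torus_aut m\<^esub> h = h"
proof -
  interpret T: group "torus_aut m"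
    unfolding torus_aut_def by (rule graph_aut_group)
  have "\<one>\<^bsub>torus_aut m\<^esub> = (\<lambda>p\<in>positions m. p)"
    by (simp add: torus_aut_def graph_aut_def BijGroup_def)
  moreover have "h \<in> extensional (positions m)"
    using assms by (simp add: most_perfect_hypercubes_def)
  ultimately show ?thesis
    unfolding hypercube_action_apply[OF T.one_closed assms] T.inv_one
    by (intro extensionalityI[of _ "positions m"]) simp_all
qed

text \<open>Any one hypercube h is injective on positions, so equal images of h force equal inverses
  and hence equal automorphisms.\<close>

lemma hypercube_action_faithful:
  assumes m: "m \<ge> 1"
  shows "faithful_action (torus_aut m) (most_perfect_hypercubes m) (hypercube_action m)"
proof -
  interpret T: group "torus_aut m"
    unfolding torus_aut_def by (rule graph_aut_group)
  let ?E = "most_perfect_hypercubes m"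
  have bij: "hypercube_action m g \<in> Bij ?E" if g: "g \<in> carrier (torus_aut m)" for g
  proof -
    have "hypercube_action m (inv\<^bsub>torus_aut m\<^esub> g) (hypercube_action m g h) = h"
      "hypercube_action m g (hypercube_action m (inv\<^bsub>torus_aut m\<^esub> g) h) = h" if "h \<in> ?E" for h
      using hypercube_action_mult[OF m T.inv_closed[OF g] g that] hypercube_action_one[OF that]
        hypercube_action_mult[OF m g T.inv_closed[OF g] that] g by simp_all
    then have "bij_betw (hypercube_action m g) ?E ?E"
      using hypercube_action_in[OF m g] hypercube_action_in[OF m T.inv_closed[OF g]]
      by (intro bij_betw_byWitness[where f' = "hypercube_action m (inv\<^bsub>torus_aut m\<^esub> g)"]) blast+
    then show ?thesis
      by (simp add: Bij_def hypercube_action_def)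
  qed
  have "hypercube_action m \<in> hom (torus_aut m) (BijGroup ?E)"
  proof (rule homI)
    fix f g assume f: "f \<in> carrier (torus_aut m)" and g: "g \<in> carrier (torus_aut m)"
    show "hypercube_action m f \<in> carrier (BijGroup ?E)"
      using bij[OF f] by (simp add: BijGroup_def)
    have "hypercube_action m (f \<otimes>\<^bsub>torus_aut m\<^esub> g) = compose ?E (hypercube_action m f) (hypercube_action m g)"
      using hypercube_action_mult[OF m f g]
      by (intro extensionalityI[of _ ?E]) (simp_all add: compose_eq hypercube_action_def)
    then show "hypercube_action m (f \<otimes>\<^bsub>torus_aut m\<^esub> g) =
        hypercube_action m f \<otimes>\<^bsub>BijGroup ?E\<^esub> hypercube_action m g"
      using bij[OF f] bij[OF g] by (simp add: BijGroup_def)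
  qed
  then have "group_hom (torus_aut m) (BijGroup ?E) (hypercube_action m)"
    by (simp add: group_hom_def group_hom_axioms_def T.is_group group_BijGroup)
  moreover have "inj_on (hypercube_action m) (carrier (torus_aut m))"
  proof (rule inj_onI)
    fix f g assume f: "f \<in> carrier (torus_aut m)" and g: "g \<in> carrier (torus_aut m)"
      and eq: "hypercube_action m f = hypercube_action m g"
    let ?f = "inv\<^bsub>torus_aut m\<^esub> f" and ?g = "inv\<^bsub>torus_aut m\<^esub> g"
    obtain h where h: "h \<in> ?E"
      using most_perfect_nonempty[OF m] by blast
    then have inj: "inj_on h (positions m)"
      by (simp add: most_perfect_hypercubes_def bij_betw_def)
    have "?f p = ?g p" if p: "p \<in> positions m" for p
    proof -
      have "hypercube_action m f h p = hypercube_action m g h p"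
        using eq by simp
      then have "h (?f p) = h (?g p)"
        using p by (simp add: hypercube_action_apply[OF f h] hypercube_action_apply[OF g h])
      then show ?thesis
        by (rule inj_onD[OF inj]) (use torus_autD(3) T.inv_closed f g p in blast)+
    qed
    then have "?f = ?g"
      using torus_autD(1)[OF T.inv_closed[OF f]] torus_autD(1)[OF T.inv_closed[OF g]]
      by (intro extensionalityI[of _ "positions m"]) (simp_all add: Bij_def)
    then show "f = g"
      using T.inv_inv[OF f] T.inv_inv[OF g] by metis
  qed
  ultimately show ?thesis
    by (simp add: faithful_action_def faithful_action_axioms_def group_action_def)
qed

lemma hypercube_action_orbit:
  assumes m: "m \<ge> 1" and h: "h \<in> most_perfect_hypercubes m"
  shows "orbit (torus_aut m) (hypercube_action m) h = most_perfect_hypercubes m"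
proof -
  interpret T: group "torus_aut m"
    unfolding torus_aut_def by (rule graph_aut_group)
  have "\<exists>g\<in>carrier (torus_aut m). h' = hypercube_action m g h"
    if h': "h' \<in> most_perfect_hypercubes m" for h'
  proof -
    obtain g where g: "g \<in> carrier (torus_aut m)" "h' = (\<lambda>p\<in>positions m. h (g p))"
      using most_perfect_transitive[OF m h h'] .
    \<comment> \<open>Transitivity supplies a precomposition with g, which is the action of
      g^-1.\<close>
    then have "h' = hypercube_action m (inv\<^bsub>torus_aut m\<^esub> g) h"
      using hypercube_action_apply[OF T.inv_closed[OF g(1)] h] T.inv_inv[OF g(1)] by simp
    then show ?thesis
      using T.inv_closed[OF g(1)] by blast
  qed
  then show ?thesis
    using hypercube_action_in[OF m _ h] unfolding orbit_def by blast
qed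

theorem theorem10:
  fixes m :: nat
  assumes "m \<ge> 1"
  shows "weyl_B (2 * m) \<cong> cube_aut (2 * m) \<and>
         cube_aut (2 * m) \<cong> torus_aut m \<and>
         torus_aut m \<cong> C2_power_semidirect_sym (2 * m) \<and>
         most_perfect_hypercubes m \<noteq> {} \<and>
         faithful_action (torus_aut m) (most_perfect_hypercubes m) (hypercube_action m) \<and>
         orbits (torus_aut m) (most_perfect_hypercubes m) (hypercube_action m)
           = {most_perfect_hypercubes m}"
proof (intro conjI)
  \<comment> \<open>Reversing an isomorphism requires its source to be a group; here this is always
    the semidirect product.\<close>
  interpret S: group "C2_power_semidirect_sym (2 * m)"
    by (rule C2_sym_group)
  show "weyl_B (2 * m) \<cong> cube_aut (2 * m)"
    using S.iso_sym[OF C2_sym_iso_weyl_B] C2_sym_iso_cube_aut by (rule iso_trans)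
  show "cube_aut (2 * m) \<cong> torus_aut m"
    by (rule cube_aut_iso_torus_aut)
  show "torus_aut m \<cong> C2_power_semidirect_sym (2 * m)"
    using C2_sym_iso_cube_aut cube_aut_iso_torus_aut by (intro S.iso_sym) (rule iso_trans)
  show "most_perfect_hypercubes m \<noteq> {}"
    using assms by (rule most_perfect_nonempty)
  show "faithful_action (torus_aut m) (most_perfect_hypercubes m) (hypercube_action m)"
    using assms by (rule hypercube_action_faithful)
  show "orbits (torus_aut m) (most_perfect_hypercubes m) (hypercube_action m)
      = {most_perfect_hypercubes m}"
    using hypercube_action_orbit[OF assms] most_perfect_nonempty[OF assms]
    unfolding orbits_def by blast
qed

end
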